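(* Let $\nu>0$ and consider the generalized Cauchy density $\pi_\nu^X\propto\exp(-V_\nu)$ on $\mathbb{R}^d$, where $V_\nu(x)=\frac{d+\nu}{2}\ln(1+|x|^2)$. Let $x_k$ denote the $k$-th iterate of the Gaussian proximal sampler with target $\pi_\nu^X$, let $\rho_k^X=\mathrm{Law}(x_k)$, and choose the step size $\eta=\tilde{\mathcal{O}}\big(1/(Ld^{1/2})\big)$, where $L=d+\nu$ is the Lipschitz constant of $\nabla V_\nu$. Assume $|x_0|\le\mathcal{O}(\sqrt d)$. Then achieving $\mathrm{TV}(\pi_\nu^X,\rho_N^X)\le\varepsilon$ requires $$N\ge\tilde\Omega_\nu\big(d^{3/2}\varepsilon^{-2/\nu}\big)$$ iterations.
   Context: $|\cdot|$ is the Euclidean norm and $\mathrm{TV}(\mu,\nu)=\sup_A|\mu(A)-\nu(A)|$. The Gaussian proximal sampler with step size $\eta>0$ and target $\pi^X$ is the Markov chain which, started from a (random) $x_0$, at each iteration $k=0,1,2,\dots$ (i) samples $y_k\mid x_k\sim\mathcal{N}(x_k,\eta I_d)$, and (ii) samples $x_{k+1}\mid y_k$ from the density proportional to $\pi^X(\cdot)\exp\big(-|\cdot-y_k|^2/(2\eta)\big)$. The assumption $|x_0|\le\mathcal{O}(\sqrt d)$ means $|x_0|\le C_0\sqrt d$ almost surely for an absolute constant $C_0$. $\tilde{\mathcal{O}}$ and $\tilde\Omega_\nu$ hide constants depending only on $\nu$ (and $C_0$) and factors polylogarithmic in $d$ and $1/\varepsilon$; the lower bound is for all sufficiently small $\varepsilon>0$.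 *)

theory Defs
  imports "HOL-Probability.Probability"
begin

text \<open>
  The dimension is quantified inside the statement (the hidden constants must not depend on it), so
  points of \<open>\<real>\<^sup>d\<close> are functions in the product space over the index set \<open>{..<d}\<close>.
\<close>

definition lebesgue_Rd :: "nat \<Rightarrow> (nat \<Rightarrow> real) measure" where
  "lebesgue_Rd d = (\<Pi>\<^sub>M i\<in>{..<d}. lborel)"

definition norm_Rd :: "nat \<Rightarrow> (nat \<Rightarrow> real) \<Rightarrow> real" where
  "norm_Rd d x = L2_set x {..<d}"

definition dist_Rd :: "nat \<Rightarrow> (nat \<Rightarrow> real) \<Rightarrow> (nat \<Rightarrow> real) \<Rightarrow> real" where
  "dist_Rd d x y = L2_set (\<lambda>i. x i - y i) {..<d}"

definition TV :: "'a measure \<Rightarrow> 'a measure \<Rightarrow> real" where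
  "TV \<mu> \<nu> = (SUP A\<in>sets \<mu>. \<bar>measure \<mu> A - measure \<nu> A\<bar>)"

text \<open>The probability density on \<open>\<real>\<^sup>d\<close> proportional to an integrable \<open>f \<ge> 0\<close> with positive integral.\<close>

definition normalize_Rd :: "nat \<Rightarrow> ((nat \<Rightarrow> real) \<Rightarrow> real) \<Rightarrow> (nat \<Rightarrow> real) \<Rightarrow> real" where
  "normalize_Rd d f x = f x / (LINT z|lebesgue_Rd d. f z)"

definition law_of_density :: "nat \<Rightarrow> ((nat \<Rightarrow> real) \<Rightarrow> real) \<Rightarrow> (nat \<Rightarrow> real) measure" where
  "law_of_density d p = density (lebesgue_Rd d) (\<lambda>x. ennreal (p x))"

text \<open>\<open>N(x, \<eta> I\<^sub>d)\<close>; note that \<^const>\<open>normal_density\<close> is parametrised by the standard deviation.\<close>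

definition gaussian :: "nat \<Rightarrow> real \<Rightarrow> (nat \<Rightarrow> real) \<Rightarrow> (nat \<Rightarrow> real) measure" where
  "gaussian d \<eta> x = law_of_density d (\<lambda>y. \<Prod>i<d. normal_density (x i) (sqrt \<eta>) (y i))"

text \<open>Step (ii): the law of \<open>x\<^bsub>k+1\<^esub>\<close> given \<open>y\<^sub>k = y\<close>, for a target with density \<open>p\<close>.\<close>

definition restricted_gaussian ::
  "nat \<Rightarrow> real \<Rightarrow> ((nat \<Rightarrow> real) \<Rightarrow> real) \<Rightarrow> (nat \<Rightarrow> real) \<Rightarrow> (nat \<Rightarrow> real) measure" where
  "restricted_gaussian d \<eta> p y =
     law_of_density d (normalize_Rd d (\<lambda>x. p x * exp (- (dist_Rd d x y)\<^sup>2 / (2 * \<eta>))))"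

text \<open>\<open>Law(x\<^sub>k)\<close> for the Markov chain started from \<open>x\<^sub>0 \<sim> \<rho>0\<close>; \<open>\<bind>\<close> applies a Markov kernel to a law.\<close>

primrec proximal_law ::
  "nat \<Rightarrow> real \<Rightarrow> ((nat \<Rightarrow> real) \<Rightarrow> real) \<Rightarrow> (nat \<Rightarrow> real) measure \<Rightarrow> nat \<Rightarrow> (nat \<Rightarrow> real) measure" where
  "proximal_law d \<eta> p \<rho>0 0 = \<rho>0"
| "proximal_law d \<eta> p \<rho>0 (Suc k) =
     (proximal_law d \<eta> p \<rho>0 k \<bind> gaussian d \<eta>) \<bind> restricted_gaussian d \<eta> p"

definition cauchy_potential :: "nat \<Rightarrow> real \<Rightarrow> (nat \<Rightarrow> real) \<Rightarrow> real" where
  "cauchy_potential d \<nu> x = (real d + \<nu>) / 2 * ln (1 + (norm_Rd d x)\<^sup>2)"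

definition cauchy_density :: "nat \<Rightarrow> real \<Rightarrow> (nat \<Rightarrow> real) \<Rightarrow> real" where
  "cauchy_density d \<nu> = normalize_Rd d (\<lambda>x. exp (- cauchy_potential d \<nu> x))"

text \<open>
  A polylogarithmic factor: every product of powers of \<open>ln d\<close> and \<open>ln (1/\<epsilon>)\<close> is bounded by
  one of these when \<open>d \<ge> 1\<close> and \<open>0 < \<epsilon> < 1\<close>.
\<close>

definition polylog :: "nat \<Rightarrow> nat \<Rightarrow> real \<Rightarrow> real" where
  "polylog m d \<epsilon> = (1 + ln (real d) + ln (1 / \<epsilon>)) ^ m"

end

theory Submission
  imports Defs "HOL-Real_Asymp.Real_Asymp"
begin

text \<open>
  The target is heavy-tailed while the chain moves no faster than a random walk.

  \<^item> Since \<open>\<pi>\<close> is radially decreasing, Chebyshev's association inequality shows that for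
    every increasing function of \<open>|x|\<close> the expectation under step (ii) is at most that under
    \<open>N(y, \<eta> I)\<close>. So \<open>x\<^sub>N\<close> has exponential moments of \<open>|x|\<^sup>2\<close> bounded by those of
    \<open>x\<^sub>0 + sqrt (2 N \<eta>) Z\<close>, whatever the size of \<open>\<eta>\<close>, and
    \<open>P(|x\<^sub>N| > R) \<le> exp (2 - R\<^sup>2 / ((8 \<eta> N + C\<^sub>0\<^sup>2) d))\<close>.

  \<^item> Dilating by \<open>s \<ge> 1\<close> gives \<open>\<pi>(|x| > s r) \<ge> s powr -\<nu> \<pi>(|x| > r)\<close>, and dilating by 2
    shows that \<open>\<pi>(|x| > a sqrt d) \<ge> 1/3\<close> with \<open>a\<close> independent of \<open>d\<close>: in high dimension
    doubling a ball of radius \<open>a sqrt d\<close> at least doubles its mass.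

  Comparing both at the radius \<open>R\<close> of order \<open>sqrt d \<epsilon> powr (-1/\<nu>)\<close> with \<open>\<pi>(|x| > R) \<ge> 2 \<epsilon>\<close> forces
  \<open>(\<eta> N + 1) ln (1/\<epsilon>)\<close> to be at least of order \<open>\<epsilon> powr (-2/\<nu>)\<close>,
  and the upper bound on \<open>\<eta>\<close> turns this into the lower bound on \<open>N\<close>.
\<close>

section \<open>Lebesgue measure on R^d: norms, dilations and product integrands\<close>

lemma product_sigma_finite_lborel: "product_sigma_finite (\<lambda>_. lborel :: real measure)"
  by standard

lemma space_lebesgue_Rd: "space (lebesgue_Rd d) = {..<d} \<rightarrow>\<^sub>E UNIV"
  by (simp add: lebesgue_Rd_def space_PiM)

lemma sigma_finite_lebesgue_Rd: "sigma_finite_measure (lebesgue_Rd d)"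
  unfolding lebesgue_Rd_def
  by (rule product_sigma_finite.sigma_finite[OF product_sigma_finite_lborel]) simp

lemma measurable_coordinate_Rd [measurable]:
  "i < d \<Longrightarrow> (\<lambda>x. x i) \<in> borel_measurable (lebesgue_Rd d)"
  unfolding lebesgue_Rd_def using measurable_component_singleton[of i "{..<d}" "\<lambda>_. lborel"] by simp

lemma norm_Rd_power2: "(norm_Rd d x)\<^sup>2 = (\<Sum>i<d. (x i)\<^sup>2)"
  by (simp add: norm_Rd_def L2_set_def sum_nonneg)

lemma dist_Rd_power2: "(dist_Rd d x y)\<^sup>2 = (\<Sum>i<d. (x i - y i)\<^sup>2)"
  by (simp add: dist_Rd_def L2_set_def sum_nonneg)

lemma norm_Rd_nonneg: "0 \<le> norm_Rd d x"
  by (simp add: norm_Rd_def)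

lemma borel_measurable_norm_Rd [measurable]: "norm_Rd d \<in> borel_measurable (lebesgue_Rd d)"
  unfolding norm_Rd_def L2_set_def by measurable

lemma norm_Rd_scale: "0 \<le> s \<Longrightarrow> norm_Rd d (\<lambda>i\<in>{..<d}. s * x i) = s * norm_Rd d x"
  by (simp add: norm_Rd_def L2_set_def power_mult_distrib sum_distrib_left[symmetric] real_sqrt_mult)

lemma measurable_scale_Rd [measurable]:
  "(\<lambda>x. \<lambda>i\<in>{..<d}. s * x i) \<in> lebesgue_Rd d \<rightarrow>\<^sub>M lebesgue_Rd d"
  unfolding lebesgue_Rd_def by measurable

text \<open>A measure on a finite product is determined by its values on boxes, where the claim
  reduces to scaling in each coordinate. The restriction to \<open>{..<d}\<close> keeps the dilated
  point extensional, hence inside the product space.\<close>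

lemma lebesgue_Rd_scale:
  assumes s: "s > 0"
  shows "density (distr (lebesgue_Rd d) (lebesgue_Rd d) (\<lambda>x. \<lambda>i\<in>{..<d}. s * x i)) (\<lambda>_. ennreal (s ^ d))
    = lebesgue_Rd d"
proof -
  interpret product_sigma_finite "\<lambda>_::nat. lborel :: real measure"
    by (rule product_sigma_finite_lborel)
  let ?M = "density (distr (lebesgue_Rd d) (lebesgue_Rd d) (\<lambda>x. \<lambda>i\<in>{..<d}. s * x i)) (\<lambda>_. ennreal (s ^ d))"
  have "?M = Pi\<^sub>M {..<d} (\<lambda>_. lborel)"
  proof (rule PiM_eqI)
    fix A :: "nat \<Rightarrow> real set" assume A: "\<And>i. i \<in> {..<d} \<Longrightarrow> A i \<in> sets lborel"
    have [measurable]: "Pi\<^sub>E {..<d} A \<in> sets (lebesgue_Rd d)"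
      unfolding lebesgue_Rd_def using A by (intro sets_PiM_I_finite) auto
    define B where "B i = (\<lambda>x. s * x) -` A i" for i
    have B: "B i \<in> sets lborel" if "i \<in> {..<d}" for i
      using measurable_sets[of "\<lambda>x. s * x" borel borel "A i"] A[OF that] by (simp add: B_def)
    have AB: "emeasure lborel (A i) = ennreal s * emeasure lborel (B i)" if "i \<in> {..<d}" for i
    proof -
      have "emeasure lborel (A i) = (\<integral>\<^sup>+x. indicator (A i) x \<partial>lborel)"
        using A[OF that] by simp
      also have "\<dots> = ennreal s * (\<integral>\<^sup>+x. indicator (A i) (0 + s * x) \<partial>lborel)"
        using A[OF that] s by (subst nn_integral_real_affine[where c = s and t = 0]) auto
      also have "(\<lambda>x. indicator (A i) (0 + s * x) :: ennreal) = indicator (B i)"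
        by (auto simp: B_def indicator_def fun_eq_iff)
      finally show ?thesis using B[OF that] by simp
    qed
    have "(\<lambda>x. \<lambda>i\<in>{..<d}. s * x i) -` Pi\<^sub>E {..<d} A \<inter> space (lebesgue_Rd d) = Pi\<^sub>E {..<d} B"
    proof (intro set_eqI iffI)
      fix x assume "x \<in> Pi\<^sub>E {..<d} B"
      then show "x \<in> (\<lambda>x. \<lambda>i\<in>{..<d}. s * x i) -` Pi\<^sub>E {..<d} A \<inter> space (lebesgue_Rd d)"
        unfolding space_lebesgue_Rd B_def by (simp add: PiE_iff)
    next
      fix x assume "x \<in> (\<lambda>x. \<lambda>i\<in>{..<d}. s * x i) -` Pi\<^sub>E {..<d} A \<inter> space (lebesgue_Rd d)"
      then show "x \<in> Pi\<^sub>E {..<d} B"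
        unfolding space_lebesgue_Rd B_def by (simp add: PiE_iff)
    qed
    then have "emeasure ?M (Pi\<^sub>E {..<d} A) = ennreal (s ^ d) * emeasure (lebesgue_Rd d) (Pi\<^sub>E {..<d} B)"
      by (simp add: emeasure_density_const emeasure_distr)
    also have "\<dots> = ennreal (s ^ d) * (\<Prod>i<d. emeasure lborel (B i))"
      unfolding lebesgue_Rd_def using B by (subst emeasure_PiM) auto
    also have "\<dots> = (\<Prod>i<d. emeasure lborel (A i))"
      using s AB by (simp add: prod.distrib ennreal_power)
    finally show "emeasure ?M (Pi\<^sub>E {..<d} A) = (\<Prod>i<d. emeasure lborel (A i))" .
  qed (simp_all add: lebesgue_Rd_def)
  then show ?thesis by (simp add: lebesgue_Rd_def)
qed

lemma nn_integral_Rd_scale: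
  assumes [measurable]: "f \<in> borel_measurable (lebesgue_Rd d)" and s: "s > 0"
  shows "(\<integral>\<^sup>+x. f x \<partial>lebesgue_Rd d) = ennreal (s ^ d) * (\<integral>\<^sup>+x. f (\<lambda>i\<in>{..<d}. s * x i) \<partial>lebesgue_Rd d)"
  by (subst lebesgue_Rd_scale[OF s, symmetric])
    (simp add: nn_integral_density nn_integral_distr nn_integral_cmult)

lemma nn_integral_Rd_prod:
  assumes "\<And>i. i < d \<Longrightarrow> f i \<in> borel_measurable borel"
  shows "(\<integral>\<^sup>+x. (\<Prod>i<d. f i (x i)) \<partial>lebesgue_Rd d) = (\<Prod>i<d. \<integral>\<^sup>+t. f i t \<partial>lborel)"
  unfolding lebesgue_Rd_def using assms
  by (intro product_sigma_finite.product_nn_integral_prod product_sigma_finite_lborel) auto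

lemma emeasure_lebesgue_Rd_space: "emeasure (lebesgue_Rd d) (space (lebesgue_Rd d)) \<noteq> 0"
  using product_sigma_finite.emeasure_PiM[OF product_sigma_finite_lborel, of "{..<d}" "\<lambda>_. UNIV"]
  by (simp add: lebesgue_Rd_def space_PiM)

text \<open>A nonnegative integrable function with zero integral vanishes almost everywhere, which
  positivity excludes because the whole space is not null. It guarantees that the normalising
  constants are not zero.\<close>

lemma integral_Rd_pos:
  fixes f :: "(nat \<Rightarrow> real) \<Rightarrow> real"
  assumes f: "integrable (lebesgue_Rd d) f" and pos: "\<And>x. f x > 0"
  shows "(LINT x|lebesgue_Rd d. f x) > 0"
proof -
  have "(LINT x|lebesgue_Rd d. f x) \<noteq> 0"
  proof
    assume "(LINT x|lebesgue_Rd d. f x) = 0"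
    then have "AE x in lebesgue_Rd d. f x = 0"
      using integral_nonneg_eq_0_iff_AE[OF f] pos by (simp add: less_imp_le)
    moreover have "f x \<noteq> 0" for x using pos[of x] by simp
    ultimately have "AE x in lebesgue_Rd d. False" by simp
    then show False
      using emeasure_lebesgue_Rd_space by (simp add: AE_iff_null null_sets_def)
  qed
  then show ?thesis
    using Bochner_Integration.integral_nonneg[of "lebesgue_Rd d" f] pos by (simp add: less_le less_imp_le)
qed

section \<open>Integrability of the Cauchy weight\<close>

text \<open>Comparison with \<open>(1 + x)\<^sup>-\<^sup>1\<^sup>-\<^sup>\<delta>\<close> through \<open>(1 + x)\<^sup>2 \<le> 2 (1 + x\<^sup>2)\<close>.\<close>

lemma nn_integral_cauchy_1d_finite:
  assumes \<delta>: "\<delta> > 0"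
  shows "(\<integral>\<^sup>+x. ennreal ((1 + x\<^sup>2) powr (- (1 + \<delta>) / 2)) \<partial>lborel) < \<infinity>"
proof -
  let ?f = "\<lambda>x::real. (1 + x\<^sup>2) powr (- (1 + \<delta>) / 2)"
  let ?g = "\<lambda>x::real. (1 + x) powr (- (1 + \<delta>))"
  define C where "C = 2 powr ((1 + \<delta>) / 2)"
  have fg: "?f x \<le> C * ?g x" if "x \<ge> 0" for x :: real
  proof -
    have "(1 + x)\<^sup>2 / 2 \<le> 1 + x\<^sup>2"
      using sum_squares_bound[of 1 x] by (simp add: power2_eq_square algebra_simps)
    then have "?f x \<le> ((1 + x)\<^sup>2 / 2) powr (- (1 + \<delta>) / 2)"
      using that \<delta> by (intro powr_mono2') (auto simp: add_nonneg_pos)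
    also have "\<dots> = ((1 + x)\<^sup>2) powr (- (1 + \<delta>) / 2) / 2 powr (- (1 + \<delta>) / 2)"
      by (rule powr_divide)
    also have "((1 + x)\<^sup>2) powr (- (1 + \<delta>) / 2) = ?g x"
    proof -
      have h: "2 * (- (1 + \<delta>) / 2) = - (1 + \<delta>)" by simp
      have "(1 + x)\<^sup>2 = (1 + x) powr 2" using that by simp
      then show ?thesis by (simp only: powr_powr h)
    qed
    also have "?g x / 2 powr (- (1 + \<delta>) / 2) = C * ?g x"
    proof -
      have "C * 2 powr (- (1 + \<delta>) / 2) = 1"
        unfolding C_def powr_add[symmetric] by (simp add: add_divide_distrib diff_divide_distrib)
      then show ?thesis by (simp add: field_simps)
    qed
    finally show ?thesis .
  qed
  \<comment> \<open>The antiderivative of \<open>?g\<close> is -(1 + x) powr (-\<delta>) / \<delta>,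
    which vanishes at infinity because \<delta> > 0.\<close>
  have "((\<lambda>x. - ((1 + x) powr (-\<delta>)) / \<delta>) \<longlongrightarrow> - 0 / \<delta>) at_top"
    using \<delta> by (intro tendsto_intros tendsto_neg_powr filterlim_tendsto_add_at_top[OF tendsto_const filterlim_ident]) auto
  moreover have "((\<lambda>x. - ((1 + x) powr (-\<delta>)) / \<delta>) has_real_derivative ?g x) (at x)" if "x \<ge> 0" for x
  proof -
    have e: "- (1 + \<delta>) = - \<delta> - 1" by simp
    show ?thesis
      unfolding e using that \<delta> by (auto intro!: derivative_eq_intros)
  qed
  ultimately have "(\<integral>\<^sup>+x. ennreal (?g x) * indicator {0..} x \<partial>lborel)
      = ennreal (- 0 / \<delta> - (- ((1 + 0) powr (-\<delta>)) / \<delta>))"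
    by (intro nn_integral_FTC_atLeast) auto
  moreover have "(\<integral>\<^sup>+x. ennreal (C * ?g x) * indicator {0..} x \<partial>lborel)
      = ennreal C * (\<integral>\<^sup>+x. ennreal (?g x) * indicator {0..} x \<partial>lborel)"
    by (simp add: ennreal_mult' C_def mult.assoc nn_integral_cmult)
  ultimately have fin: "(\<integral>\<^sup>+x. ennreal (C * ?g x) * indicator {0..} x \<partial>lborel) < \<infinity>"
    by (simp add: ennreal_mult_less_top)
  have half: "(\<integral>\<^sup>+x. ennreal (?f x) * indicator {0..} x \<partial>lborel) < \<infinity>"
    using ennreal_leI[OF fg]
    by (intro le_less_trans[OF nn_integral_mono fin]) (auto simp: indicator_def)
  \<comment> \<open>The even integrand is split into two half-lines. At 0 both indicators are 1, so
    the pointwise bound is only an inequality.\<close>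
  have "(\<integral>\<^sup>+x. ennreal (?f x) \<partial>lborel)
      \<le> (\<integral>\<^sup>+x. ennreal (?f x) * indicator {0..} x + ennreal (?f x) * indicator {0..} (0 + (-1) * x) \<partial>lborel)"
    by (intro nn_integral_mono) (auto simp: indicator_def)
  also have "\<dots> = (\<integral>\<^sup>+x. ennreal (?f x) * indicator {0..} x \<partial>lborel)
      + (\<integral>\<^sup>+x. ennreal (?f (0 + (-1) * x)) * indicator {0..} (0 + (-1) * x) \<partial>lborel)"
    by (subst nn_integral_add) auto
  also have "(\<integral>\<^sup>+x. ennreal (?f (0 + (-1) * x)) * indicator {0..} (0 + (-1) * x) \<partial>lborel)
      = (\<integral>\<^sup>+x. ennreal (?f x) * indicator {0..} x \<partial>lborel)"
    by (subst nn_integral_real_affine[where c = "-1" and t = 0]) auto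
  finally show ?thesis using half by (auto simp: order_le_less_trans)
qed

text \<open>This is exp (-V) rewritten as a power, the form in which the effect of a dilation can be
  read off.\<close>

definition cauchy_weight :: "nat \<Rightarrow> real \<Rightarrow> (nat \<Rightarrow> real) \<Rightarrow> real" where
  "cauchy_weight d \<nu> x = (1 + (norm_Rd d x)\<^sup>2) powr (- (real d + \<nu>) / 2)"

lemma one_plus_norm_Rd_pos: "0 < 1 + (norm_Rd d x)\<^sup>2"
  by (simp add: add_pos_nonneg)

lemma exp_cauchy_potential: "exp (- cauchy_potential d \<nu> x) = cauchy_weight d \<nu> x"
  using one_plus_norm_Rd_pos[of d x]
  by (simp add: cauchy_potential_def cauchy_weight_def powr_def field_simps)

lemma cauchy_weight_pos: "0 < cauchy_weight d \<nu> x"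
  using one_plus_norm_Rd_pos[of d x] by (simp add: cauchy_weight_def)

lemma borel_measurable_cauchy_weight [measurable]:
  "cauchy_weight d \<nu> \<in> borel_measurable (lebesgue_Rd d)"
  unfolding cauchy_weight_def by measurable

lemma cauchy_weight_antimono:
  assumes "norm_Rd d x \<le> norm_Rd d y" "\<nu> > 0"
  shows "cauchy_weight d \<nu> y \<le> cauchy_weight d \<nu> x"
  unfolding cauchy_weight_def using assms norm_Rd_nonneg[of d x]
  by (intro powr_mono2') (auto simp: one_plus_norm_Rd_pos power_mono)

text \<open>The decay is shared evenly among the coordinates: every 1 + x_i^2 is at most 1 + |x|^2,
  so the weight is at most a product of one-dimensional weights with exponent -(1 + \<delta>) / 2.
  The choice \<delta> = \<nu> / d makes the exponents add up to the right total, and \<delta> > 0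
  keeps every factor integrable.\<close>

lemma integrable_cauchy_weight:
  assumes d: "d \<ge> 1" and \<nu>: "\<nu> > 0"
  shows "integrable (lebesgue_Rd d) (cauchy_weight d \<nu>)"
proof (rule integrableI_bounded)
  define \<delta> where "\<delta> = \<nu> / real d"
  have \<delta>: "\<delta> > 0" and e: "real d * (- (1 + \<delta>) / 2) = - (real d + \<nu>) / 2"
    using d \<nu> by (simp_all add: \<delta>_def field_simps)
  have le: "cauchy_weight d \<nu> x \<le> (\<Prod>i<d. (1 + (x i)\<^sup>2) powr (- (1 + \<delta>) / 2))" for x
  proof -
    let ?P = "\<Prod>i<d. (1 + (x i)\<^sup>2)"
    have "?P \<le> (\<Prod>i<d. (1 + (norm_Rd d x)\<^sup>2))"
      unfolding norm_Rd_power2 by (intro prod_mono) (auto intro: member_le_sum)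
    then have "?P \<le> (1 + (norm_Rd d x)\<^sup>2) ^ d" by simp
    moreover have "0 < ?P" by (intro prod_pos) (simp add: add_pos_nonneg)
    ultimately have "((1 + (norm_Rd d x)\<^sup>2) ^ d) powr (- (1 + \<delta>) / 2) \<le> ?P powr (- (1 + \<delta>) / 2)"
      using \<delta> by (intro powr_mono2') auto
    also have "?P powr (- (1 + \<delta>) / 2) = (\<Prod>i<d. (1 + (x i)\<^sup>2) powr (- (1 + \<delta>) / 2))"
      by (simp add: prod_powr_distrib)
    also have "((1 + (norm_Rd d x)\<^sup>2) ^ d) powr (- (1 + \<delta>) / 2) = cauchy_weight d \<nu> x"
      unfolding cauchy_weight_def powr_realpow[OF one_plus_norm_Rd_pos, symmetric] powr_powr e ..
    finally show ?thesis .
  qed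
  have "(\<integral>\<^sup>+x. ennreal (norm (cauchy_weight d \<nu> x)) \<partial>lebesgue_Rd d)
      \<le> (\<integral>\<^sup>+x. (\<Prod>i<d. ennreal ((1 + (x i)\<^sup>2) powr (- (1 + \<delta>) / 2))) \<partial>lebesgue_Rd d)"
    using ennreal_leI[OF le]
    by (intro nn_integral_mono) (simp add: prod_ennreal cauchy_weight_pos less_imp_le)
  also have "\<dots> = (\<Prod>i<d. \<integral>\<^sup>+t. ennreal ((1 + t\<^sup>2) powr (- (1 + \<delta>) / 2)) \<partial>lborel)"
    by (rule nn_integral_Rd_prod) measurable
  also have "\<dots> < \<infinity>"
    using nn_integral_cauchy_1d_finite[OF \<delta>] by (simp add: power_less_top_ennreal)
  finally show "(\<integral>\<^sup>+x. ennreal (norm (cauchy_weight d \<nu> x)) \<partial>lebesgue_Rd d) < \<infinity>" .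
qed simp

section \<open>Chebyshev's association inequality\<close>

text \<open>Writing b = a + e and d = c + e' avoids subtraction in \<open>ennreal\<close>; the right
  side then exceeds the left by e * e'.\<close>

lemma ennreal_rearrangement:
  fixes a b c d :: ennreal
  assumes "a \<le> b" "c \<le> d"
  shows "a * d + b * c \<le> a * c + b * d"
proof -
  obtain e e' where "b = a + e" "d = c + e'"
    using assms by (auto simp: le_iff_add)
  then show ?thesis
    by (simp add: distrib_left distrib_right add_ac)
qed

text \<open>The rearrangement inequality for the values at two independent points, integrated over
  both, gives twice the claim.\<close>

lemma chebyshev_association:
  fixes f g :: "'a \<Rightarrow> ennreal"
  assumes "prob_space M"
    and [measurable]: "f \<in> borel_measurable M" "g \<in> borel_measurable M"
    and opp: "\<And>x y. (f x \<le> f y \<and> g y \<le> g x) \<or> (f y \<le> f x \<and> g x \<le> g y)"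
  shows "(\<integral>\<^sup>+x. f x * g x \<partial>M) \<le> (\<integral>\<^sup>+x. f x \<partial>M) * (\<integral>\<^sup>+x. g x \<partial>M)"
proof -
  interpret prob_space M by fact
  have pointwise: "f x * g x + f y * g y \<le> f x * g y + f y * g x" for x y
    using opp[of x y] ennreal_rearrangement[of "f x" "f y" "g y" "g x"]
      ennreal_rearrangement[of "f y" "f x" "g x" "g y"]
    by (auto simp: add_ac)
  have "2 * (\<integral>\<^sup>+x. f x * g x \<partial>M) = (\<integral>\<^sup>+x. \<integral>\<^sup>+y. f x * g x + f y * g y \<partial>M \<partial>M)"
    by (simp add: nn_integral_add emeasure_space_1 mult_2)
  also have "\<dots> \<le> (\<integral>\<^sup>+x. \<integral>\<^sup>+y. f x * g y + f y * g x \<partial>M \<partial>M)"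
    by (intro nn_integral_mono pointwise)
  also have "\<dots> = 2 * ((\<integral>\<^sup>+x. f x \<partial>M) * (\<integral>\<^sup>+x. g x \<partial>M))"
    by (simp add: nn_integral_add nn_integral_cmult nn_integral_multc mult_2)
  finally show ?thesis
    by (simp add: ennreal_mult_le_mult_iff)
qed

section \<open>Kernels with densities and Gaussian exponential moments\<close>

text \<open>By Tonelli, joint measurability of the density makes the mass of each fixed set
  measurable in the parameter. The integral formulas for \<open>\<bind>\<close> rest on
  measurability of the kernels.\<close>

lemma measurable_law_of_density:
  assumes [measurable]: "(\<lambda>(y, x). k y x) \<in> borel_measurable (M \<Otimes>\<^sub>M lebesgue_Rd d)"
    and prob: "\<And>y. y \<in> space M \<Longrightarrow> prob_space (law_of_density d (k y))"
  shows "(\<lambda>y. law_of_density d (k y)) \<in> M \<rightarrow>\<^sub>M prob_algebra (lebesgue_Rd d)"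
proof (rule measurable_prob_algebraI)
  interpret sigma_finite_measure "lebesgue_Rd d" by (rule sigma_finite_lebesgue_Rd)
  show "(\<lambda>y. law_of_density d (k y)) \<in> M \<rightarrow>\<^sub>M subprob_algebra (lebesgue_Rd d)"
  proof (rule measurable_subprob_algebra)
    fix A assume [measurable]: "A \<in> sets (lebesgue_Rd d)"
    have "(\<lambda>y. \<integral>\<^sup>+x. ennreal (k y x) * indicator A x \<partial>lebesgue_Rd d) \<in> borel_measurable M"
      by measurable
    moreover have "emeasure (law_of_density d (k y)) A = (\<integral>\<^sup>+x. ennreal (k y x) * indicator A x \<partial>lebesgue_Rd d)"
      if [measurable]: "y \<in> space M" for y
    proof -
      have [measurable]: "k y \<in> borel_measurable (lebesgue_Rd d)"
        using measurable_compose[OF measurable_Pair1'[OF that] assms(1)] by simp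
      show ?thesis by (simp add: law_of_density_def emeasure_density)
    qed
    ultimately show "(\<lambda>y. emeasure (law_of_density d (k y)) A) \<in> borel_measurable M"
      by (simp cong: measurable_cong)
  next
    show "subprob_space (law_of_density d (k y))" if "y \<in> space M" for y
      using prob[OF that] by (rule prob_space_imp_subprob_space)
  qed (simp add: law_of_density_def)
qed (rule prob)

lemma measurable_normal_density_Rd [measurable]:
  "(\<lambda>(y, x). \<Prod>i<d. normal_density (y i) \<sigma> (x i)) \<in> borel_measurable (lebesgue_Rd d \<Otimes>\<^sub>M lebesgue_Rd d)"
  unfolding normal_density_def by measurable

lemma measurable_normal_density_Rd' [measurable]:
  "(\<lambda>x. \<Prod>i<d. normal_density (y i) \<sigma> (x i)) \<in> borel_measurable (lebesgue_Rd d)"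
  by measurable

lemma nn_integral_gaussian:
  assumes [measurable]: "f \<in> borel_measurable (lebesgue_Rd d)"
  shows "(\<integral>\<^sup>+x. f x \<partial>gaussian d \<eta> y)
    = (\<integral>\<^sup>+x. ennreal (\<Prod>i<d. normal_density (y i) (sqrt \<eta>) (x i)) * f x \<partial>lebesgue_Rd d)"
  by (simp add: gaussian_def law_of_density_def nn_integral_density)

lemma nn_integral_gaussian_prod:
  assumes [measurable]: "\<And>i. i < d \<Longrightarrow> f i \<in> borel_measurable borel" and f: "\<And>i t. 0 \<le> f i t"
  shows "(\<integral>\<^sup>+x. ennreal (\<Prod>i<d. f i (x i)) \<partial>gaussian d \<eta> y)
    = (\<Prod>i<d. \<integral>\<^sup>+t. ennreal (normal_density (y i) (sqrt \<eta>) t * f i t) \<partial>lborel)"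
proof -
  have "(\<integral>\<^sup>+x. ennreal (\<Prod>i<d. f i (x i)) \<partial>gaussian d \<eta> y)
    = (\<integral>\<^sup>+x. (\<Prod>i<d. ennreal (normal_density (y i) (sqrt \<eta>) (x i) * f i (x i))) \<partial>lebesgue_Rd d)"
    using f by (subst nn_integral_gaussian)
      (auto simp: prod_ennreal prod_nonneg prod.distrib ennreal_mult intro!: nn_integral_cong)
  also have "\<dots> = (\<Prod>i<d. \<integral>\<^sup>+t. ennreal (normal_density (y i) (sqrt \<eta>) t * f i t) \<partial>lborel)"
    by (rule nn_integral_Rd_prod) measurable
  finally show ?thesis .
qed

lemma nn_integral_normal_density:
  "\<sigma> > 0 \<Longrightarrow> (\<integral>\<^sup>+t. ennreal (normal_density \<mu> \<sigma> t) \<partial>lborel) = 1"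
  by (simp add: nn_integral_eq_integral)

lemma prob_space_gaussian:
  assumes "\<eta> > 0"
  shows "prob_space (gaussian d \<eta> y)"
proof (rule prob_spaceI)
  have "emeasure (gaussian d \<eta> y) (space (gaussian d \<eta> y)) = (\<integral>\<^sup>+x. ennreal (\<Prod>i<d. 1) \<partial>gaussian d \<eta> y)"
    by simp
  also have "\<dots> = 1"
    using assms by (subst nn_integral_gaussian_prod) (auto simp: nn_integral_normal_density)
  finally show "emeasure (gaussian d \<eta> y) (space (gaussian d \<eta> y)) = 1" .
qed

lemma measurable_gaussian:
  "\<eta> > 0 \<Longrightarrow> gaussian d \<eta> \<in> lebesgue_Rd d \<rightarrow>\<^sub>M prob_algebra (lebesgue_Rd d)"
  unfolding gaussian_def
  by (rule measurable_law_of_density) (auto simp: prob_space_gaussian simp flip: gaussian_def)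

text \<open>Completing the square: the tilted normal density is a multiple of another one, since 1 /
  \<eta> - 2 / (v + 2 \<eta>) is the inverse of \<eta> (v + 2 \<eta>) / v. The square root in front
  compensates for the change of variance.\<close>

lemma normal_density_exp_square:
  assumes v: "v > 0" and \<eta>: "\<eta> > 0"
  shows "normal_density y (sqrt \<eta>) t * exp (t\<^sup>2 / (v + 2 * \<eta>))
    = sqrt ((v + 2 * \<eta>) / v) * exp (y\<^sup>2 / v)
      * normal_density (y * (v + 2 * \<eta>) / v) (sqrt (\<eta> * (v + 2 * \<eta>) / v)) t"
proof -
  have "- (t - y)\<^sup>2 / (2 * \<eta>) + t\<^sup>2 / (v + 2 * \<eta>)
      = y\<^sup>2 / v + - (t - y * (v + 2 * \<eta>) / v)\<^sup>2 / (2 * (\<eta> * (v + 2 * \<eta>) / v))"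
  proof -
    have "v + 2 * \<eta> > 0" using v \<eta> by simp
    then show ?thesis
      using v \<eta> by (simp add: divide_simps) (simp add: algebra_simps power2_eq_square power3_eq_cube)
  qed
  then have e: "exp (- (t - y)\<^sup>2 / (2 * \<eta>)) * exp (t\<^sup>2 / (v + 2 * \<eta>))
      = exp (y\<^sup>2 / v) * exp (- (t - y * (v + 2 * \<eta>) / v)\<^sup>2 / (2 * (\<eta> * (v + 2 * \<eta>) / v)))"
    by (simp flip: exp_add)
  have s: "1 / sqrt (2 * pi * \<eta>) = sqrt ((v + 2 * \<eta>) / v) * (1 / sqrt (2 * pi * (\<eta> * (v + 2 * \<eta>) / v)))"
    using v \<eta> by (simp add: real_sqrt_mult real_sqrt_divide)
  have "\<eta> * (v + 2 * \<eta>) / v > 0" using v \<eta> by simp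
  then have sq: "(sqrt (\<eta> * (v + 2 * \<eta>) / v))\<^sup>2 = \<eta> * (v + 2 * \<eta>) / v"
    by simp
  have sq': "(sqrt \<eta>)\<^sup>2 = \<eta>" using \<eta> by simp
  have "1 / sqrt (2 * pi * \<eta>) * exp (- (t - y)\<^sup>2 / (2 * \<eta>)) * exp (t\<^sup>2 / (v + 2 * \<eta>))
    = 1 / sqrt (2 * pi * \<eta>) * (exp (y\<^sup>2 / v) * exp (- (t - y * (v + 2 * \<eta>) / v)\<^sup>2 / (2 * (\<eta> * (v + 2 * \<eta>) / v))))"
    unfolding e[symmetric] by (rule mult.assoc)
  then show ?thesis
    unfolding normal_density_def sq sq' s by (simp only: mult_ac)
qed

text \<open>Coordinates are independent, so the one-dimensional identity is multiplied up.
  Parametrising by the width v makes a Gaussian step an additive shift by 2 \<eta> and lets the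
  constants of successive steps telescope.\<close>

lemma nn_integral_gaussian_exp_square:
  assumes v: "v > 0" and \<eta>: "\<eta> > 0"
  shows "(\<integral>\<^sup>+x. ennreal (exp ((norm_Rd d x)\<^sup>2 / (v + 2 * \<eta>))) \<partial>gaussian d \<eta> y)
    = ennreal (sqrt ((v + 2 * \<eta>) / v) ^ d) * ennreal (exp ((norm_Rd d y)\<^sup>2 / v))"
proof -
  have one: "(\<integral>\<^sup>+t. ennreal (normal_density a (sqrt \<eta>) t * exp (t\<^sup>2 / (v + 2 * \<eta>))) \<partial>lborel)
      = ennreal (sqrt ((v + 2 * \<eta>) / v)) * ennreal (exp (a\<^sup>2 / v))" for a
    unfolding normal_density_exp_square[OF v \<eta>] using v \<eta>
    by (simp add: ennreal_mult nn_integral_cmult nn_integral_normal_density)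
  have "(\<integral>\<^sup>+x. ennreal (exp ((norm_Rd d x)\<^sup>2 / (v + 2 * \<eta>))) \<partial>gaussian d \<eta> y)
      = (\<integral>\<^sup>+x. ennreal (\<Prod>i<d. exp ((x i)\<^sup>2 / (v + 2 * \<eta>))) \<partial>gaussian d \<eta> y)"
    by (simp add: norm_Rd_power2 sum_divide_distrib exp_sum)
  also have "\<dots> = (\<Prod>i<d. ennreal (sqrt ((v + 2 * \<eta>) / v)) * ennreal (exp ((y i)\<^sup>2 / v)))"
    by (subst nn_integral_gaussian_prod) (auto simp: one)
  also have "\<dots> = ennreal (sqrt ((v + 2 * \<eta>) / v) ^ d) * ennreal (exp ((norm_Rd d y)\<^sup>2 / v))"
    using v \<eta>
    by (simp add: prod.distrib prod_ennreal ennreal_power norm_Rd_power2 sum_divide_distrib exp_sum)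
  finally show ?thesis .
qed

section \<open>Exponential moments along the sampler for a radially decreasing target\<close>

locale radial_target =
  fixes d :: nat and \<eta> :: real and p :: "(nat \<Rightarrow> real) \<Rightarrow> real"
  assumes step_pos: "\<eta> > 0"
    and integrable_target: "integrable (lebesgue_Rd d) p"
    and target_pos: "\<And>x. p x > 0"
    and target_antimono: "\<And>x y. norm_Rd d x \<le> norm_Rd d y \<Longrightarrow> p y \<le> p x"
begin

lemma borel_measurable_target [measurable]: "p \<in> borel_measurable (lebesgue_Rd d)"
  using integrable_target by (rule borel_measurable_integrable)

definition tilted :: "(nat \<Rightarrow> real) \<Rightarrow> (nat \<Rightarrow> real) \<Rightarrow> real" where
  "tilted y x = p x * exp (- (dist_Rd d x y)\<^sup>2 / (2 * \<eta>))"

lemma restricted_gaussian_tilted: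
  "restricted_gaussian d \<eta> p y = law_of_density d (normalize_Rd d (tilted y))"
  by (simp only: restricted_gaussian_def tilted_def[abs_def])

lemma measurable_tilted_pair [measurable]:
  "(\<lambda>(y, x). tilted y x) \<in> borel_measurable (lebesgue_Rd d \<Otimes>\<^sub>M lebesgue_Rd d)"
  unfolding tilted_def dist_Rd_power2 by measurable

lemma measurable_tilted [measurable]: "tilted y \<in> borel_measurable (lebesgue_Rd d)"
  unfolding tilted_def dist_Rd_power2 by measurable

lemma tilted_pos: "tilted y x > 0"
  by (simp add: tilted_def target_pos)

lemma integrable_tilted: "integrable (lebesgue_Rd d) (tilted y)"
proof (rule Bochner_Integration.integrable_bound[OF integrable_target])
  show "AE x in lebesgue_Rd d. norm (tilted y x) \<le> norm (p x)"
    using step_pos by (simp add: tilted_def abs_mult mult_left_le)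
qed measurable

text \<open>Step (ii) is N(y, \<eta> I) reweighted by \<open>p\<close>; the constant in front undoes
  the Gaussian prefactor.\<close>

lemma tilted_eq:
  "tilted y x = sqrt (2 * pi * \<eta>) ^ d * ((\<Prod>i<d. normal_density (y i) (sqrt \<eta>) (x i)) * p x)"
proof -
  have "(\<Prod>i<d. normal_density (y i) (sqrt \<eta>) (x i))
      = (1 / sqrt (2 * pi * \<eta>)) ^ d * exp (- (dist_Rd d x y)\<^sup>2 / (2 * \<eta>))"
    using step_pos
    by (simp add: normal_density_def prod.distrib prod_dividef dist_Rd_power2 sum_divide_distrib exp_sum
        power_divide sum_negf[symmetric])
  then show ?thesis using step_pos by (simp add: tilted_def power_divide)
qed

text \<open>Under N(y, \<eta> I) the weight \<open>p\<close> decreases and \<open>f\<close>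
  increases with the norm. By association the mean of \<open>p * f\<close> is at most the product of
  the means, and dividing by the mean of \<open>p\<close> normalises the reweighted law.\<close>

lemma nn_integral_restricted_gaussian_le:
  assumes [measurable]: "f \<in> borel_measurable (lebesgue_Rd d)"
    and f: "\<And>x z. norm_Rd d x \<le> norm_Rd d z \<Longrightarrow> f x \<le> f z"
  shows "(\<integral>\<^sup>+x. f x \<partial>restricted_gaussian d \<eta> p y) \<le> (\<integral>\<^sup>+x. f x \<partial>gaussian d \<eta> y)"
proof -
  define Z where "Z = (LINT x|lebesgue_Rd d. tilted y x)"
  define K where "K = sqrt (2 * pi * \<eta>) ^ d"
  have K: "K \<ge> 0" using step_pos by (simp add: K_def)
  have Z: "Z > 0"
    unfolding Z_def by (rule integral_Rd_pos[OF integrable_tilted tilted_pos])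
  have tilt: "(\<integral>\<^sup>+x. ennreal (tilted y x) * g x \<partial>lebesgue_Rd d)
      = ennreal K * (\<integral>\<^sup>+x. ennreal (p x) * g x \<partial>gaussian d \<eta> y)"
    if [measurable]: "g \<in> borel_measurable (lebesgue_Rd d)" for g
    unfolding tilted_eq K_def[symmetric] using K
    by (simp add: nn_integral_gaussian nn_integral_cmult[symmetric] ennreal_mult target_pos less_imp_le
        prod_nonneg mult.assoc)
  \<comment> \<open>Up to the prefactor K, the normalising constant is the Gaussian mean of
    \<open>p\<close>, so it cancels one factor of the association inequality.\<close>
  have "ennreal Z = (\<integral>\<^sup>+x. ennreal (tilted y x) \<partial>lebesgue_Rd d)"
    unfolding Z_def using tilted_pos
    by (intro nn_integral_eq_integral[symmetric] integrable_tilted) (auto intro: less_imp_le)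
  also have "\<dots> = ennreal K * (\<integral>\<^sup>+x. ennreal (p x) \<partial>gaussian d \<eta> y)"
    using tilt[of "\<lambda>_. 1"] by simp
  finally have Z_eq: "ennreal Z = \<dots>" .
  have "(\<integral>\<^sup>+x. ennreal (p x) * f x \<partial>gaussian d \<eta> y)
      \<le> (\<integral>\<^sup>+x. ennreal (p x) \<partial>gaussian d \<eta> y) * (\<integral>\<^sup>+x. f x \<partial>gaussian d \<eta> y)"
  proof (rule chebyshev_association[OF prob_space_gaussian[OF step_pos]])
    \<comment> \<open>Norms are totally ordered, so one of the two opposite orderings always
      holds.\<close>
    show "(ennreal (p x) \<le> ennreal (p z) \<and> f z \<le> f x) \<or> (ennreal (p z) \<le> ennreal (p x) \<and> f x \<le> f z)" for x z
      using f[of x z] f[of z x] target_antimono[of x z] target_antimono[of z x]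
      by (cases "norm_Rd d x \<le> norm_Rd d z") (auto intro: ennreal_leI)
  qed (simp_all add: gaussian_def law_of_density_def)
  then have "ennreal K * (\<integral>\<^sup>+x. ennreal (p x) * f x \<partial>gaussian d \<eta> y)
      \<le> ennreal Z * (\<integral>\<^sup>+x. f x \<partial>gaussian d \<eta> y)"
    unfolding Z_eq by (simp add: mult.assoc mult_left_mono)
  then have num: "(\<integral>\<^sup>+x. ennreal (tilted y x) * f x \<partial>lebesgue_Rd d)
      \<le> ennreal Z * (\<integral>\<^sup>+x. f x \<partial>gaussian d \<eta> y)"
    by (simp add: tilt)
  have "(\<integral>\<^sup>+x. f x \<partial>restricted_gaussian d \<eta> p y)
      = (\<integral>\<^sup>+x. ennreal (1 / Z) * (ennreal (tilted y x) * f x) \<partial>lebesgue_Rd d)"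
    unfolding restricted_gaussian_tilted law_of_density_def normalize_Rd_def Z_def[symmetric]
    using Z tilted_pos
    by (subst nn_integral_density)
      (auto intro!: nn_integral_cong simp: less_imp_le mult.assoc[symmetric] ennreal_mult'[symmetric])
  also have "\<dots> = ennreal (1 / Z) * (\<integral>\<^sup>+x. ennreal (tilted y x) * f x \<partial>lebesgue_Rd d)"
    by (rule nn_integral_cmult) measurable
  also have "\<dots> \<le> ennreal (1 / Z) * (ennreal Z * (\<integral>\<^sup>+x. f x \<partial>gaussian d \<eta> y))"
    by (intro mult_left_mono num) simp
  also have "\<dots> = (\<integral>\<^sup>+x. f x \<partial>gaussian d \<eta> y)"
    using Z by (simp add: mult.assoc[symmetric] ennreal_mult'[symmetric])
  finally show ?thesis .
qed

lemma prob_space_restricted_gaussian: "prob_space (restricted_gaussian d \<eta> p y)"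
proof (rule prob_spaceI)
  define Z where "Z = (LINT x|lebesgue_Rd d. tilted y x)"
  have Z: "Z > 0"
    unfolding Z_def by (rule integral_Rd_pos[OF integrable_tilted tilted_pos])
  have "emeasure (restricted_gaussian d \<eta> p y) (space (restricted_gaussian d \<eta> p y))
      = (\<integral>\<^sup>+x. ennreal (tilted y x / Z) \<partial>lebesgue_Rd d)"
    unfolding restricted_gaussian_tilted law_of_density_def normalize_Rd_def Z_def[symmetric]
    by (simp add: emeasure_density cong: nn_integral_cong)
  also have "\<dots> = ennreal (LINT x|lebesgue_Rd d. tilted y x / Z)"
    using Z tilted_pos
    by (intro nn_integral_eq_integral integrable_divide integrable_tilted) (simp add: less_imp_le)
  also have "\<dots> = 1"
    using Z by (simp add: Z_def)
  finally show "emeasure (restricted_gaussian d \<eta> p y) (space (restricted_gaussian d \<eta> p y)) = 1" .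
qed

lemma measurable_restricted_gaussian:
  "restricted_gaussian d \<eta> p \<in> lebesgue_Rd d \<rightarrow>\<^sub>M prob_algebra (lebesgue_Rd d)"
proof -
  interpret sigma_finite_measure "lebesgue_Rd d" by (rule sigma_finite_lebesgue_Rd)
  have [measurable]: "(\<lambda>y. LINT x|lebesgue_Rd d. tilted y x) \<in> borel_measurable (lebesgue_Rd d)"
    by measurable
  have "(\<lambda>(y, x). normalize_Rd d (tilted y) x) \<in> borel_measurable (lebesgue_Rd d \<Otimes>\<^sub>M lebesgue_Rd d)"
    unfolding normalize_Rd_def by measurable
  then have "(\<lambda>y. law_of_density d (normalize_Rd d (tilted y))) \<in> lebesgue_Rd d \<rightarrow>\<^sub>M prob_algebra (lebesgue_Rd d)"
    by (rule measurable_law_of_density)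
      (simp add: prob_space_restricted_gaussian flip: restricted_gaussian_tilted)
  then show ?thesis
    by (simp add: restricted_gaussian_tilted[abs_def])
qed

lemma proximal_law_in_prob_algebra:
  assumes "\<rho>0 \<in> space (prob_algebra (lebesgue_Rd d))"
  shows "proximal_law d \<eta> p \<rho>0 k \<in> space (prob_algebra (lebesgue_Rd d))"
proof (induction k)
  case (Suc k)
  show ?case
    using prob_space_bind'[OF _ measurable_restricted_gaussian] sets_bind'[OF _ measurable_restricted_gaussian]
      prob_space_bind'[OF Suc measurable_gaussian[OF step_pos]] sets_bind'[OF Suc measurable_gaussian[OF step_pos]]
    by (simp add: space_prob_algebra)
qed (simp add: assms)

text \<open>Each half step costs 2 \<eta> of width: step (i) by the exact Gaussian formula, step
  (ii) by domination by the Gaussian. The two prefactors telescope through v + 2 \<eta>.\<close>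

lemma exp_moment_step:
  assumes \<rho>: "\<rho> \<in> space (prob_algebra (lebesgue_Rd d))" and v: "v > 0"
  shows "(\<integral>\<^sup>+x. ennreal (exp ((norm_Rd d x)\<^sup>2 / (v + 4 * \<eta>)))
        \<partial>((\<rho> \<bind> gaussian d \<eta>) \<bind> restricted_gaussian d \<eta> p))
    \<le> ennreal (sqrt ((v + 4 * \<eta>) / v) ^ d) * (\<integral>\<^sup>+x. ennreal (exp ((norm_Rd d x)\<^sup>2 / v)) \<partial>\<rho>)"
proof -
  have \<eta>: "\<eta> > 0" by (rule step_pos)
  let ?F = "\<lambda>c x. ennreal (exp ((norm_Rd d x)\<^sup>2 / c))"
  have sets_\<rho>: "sets \<rho> = sets (lebesgue_Rd d)" using \<rho> by (simp add: space_prob_algebra)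
  have G: "gaussian d \<eta> \<in> \<rho> \<rightarrow>\<^sub>M subprob_algebra (lebesgue_Rd d)"
    using measurable_gaussian[OF \<eta>] sets_\<rho>
    by (simp add: measurable_prob_algebraD cong: measurable_cong_sets)
  have sets_G: "sets (\<rho> \<bind> gaussian d \<eta>) = sets (lebesgue_Rd d)"
    by (rule sets_bind'[OF \<rho> measurable_gaussian[OF \<eta>]])
  have R: "restricted_gaussian d \<eta> p \<in> (\<rho> \<bind> gaussian d \<eta>) \<rightarrow>\<^sub>M subprob_algebra (lebesgue_Rd d)"
    using measurable_restricted_gaussian sets_G
    by (simp add: measurable_prob_algebraD cong: measurable_cong_sets)
  \<comment> \<open>The outer kernel is integrated first, hence the Gaussian formula is used here
    with v + 2 \<eta> in place of v.\<close>
  have half: "(\<integral>\<^sup>+x. ?F (v + 4 * \<eta>) x \<partial>restricted_gaussian d \<eta> p y)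
      \<le> ennreal (sqrt ((v + 4 * \<eta>) / (v + 2 * \<eta>)) ^ d) * ?F (v + 2 * \<eta>) y" for y
  proof -
    have "(\<integral>\<^sup>+x. ?F (v + 4 * \<eta>) x \<partial>restricted_gaussian d \<eta> p y)
        \<le> (\<integral>\<^sup>+x. ?F (v + 4 * \<eta>) x \<partial>gaussian d \<eta> y)"
      using v \<eta> norm_Rd_nonneg
      by (intro nn_integral_restricted_gaussian_le) (auto intro!: ennreal_leI divide_right_mono power_mono)
    also have "\<dots> = ennreal (sqrt ((v + 4 * \<eta>) / (v + 2 * \<eta>)) ^ d) * ?F (v + 2 * \<eta>) y"
    proof -
      have "v + 2 * \<eta> + 2 * \<eta> = v + 4 * \<eta>" "v + 2 * \<eta> > 0" using v \<eta> by simp_all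
      then show ?thesis using nn_integral_gaussian_exp_square[of "v + 2 * \<eta>" \<eta> d y] \<eta> by (simp only:)
    qed
    finally show ?thesis .
  qed
  have "(\<integral>\<^sup>+x. ?F (v + 4 * \<eta>) x \<partial>((\<rho> \<bind> gaussian d \<eta>) \<bind> restricted_gaussian d \<eta> p))
      = (\<integral>\<^sup>+y. \<integral>\<^sup>+x. ?F (v + 4 * \<eta>) x \<partial>restricted_gaussian d \<eta> p y \<partial>(\<rho> \<bind> gaussian d \<eta>))"
    by (rule nn_integral_bind[OF _ R]) measurable
  also have "\<dots> \<le> (\<integral>\<^sup>+y. ennreal (sqrt ((v + 4 * \<eta>) / (v + 2 * \<eta>)) ^ d) * ?F (v + 2 * \<eta>) y
      \<partial>(\<rho> \<bind> gaussian d \<eta>))"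
    by (intro nn_integral_mono half)
  also have "\<dots> = (\<integral>\<^sup>+z. \<integral>\<^sup>+y. ennreal (sqrt ((v + 4 * \<eta>) / (v + 2 * \<eta>)) ^ d) * ?F (v + 2 * \<eta>) y
      \<partial>gaussian d \<eta> z \<partial>\<rho>)"
    by (rule nn_integral_bind[OF _ G]) measurable
  also have "\<dots> = (\<integral>\<^sup>+z. ennreal (sqrt ((v + 4 * \<eta>) / (v + 2 * \<eta>)) ^ d)
      * (ennreal (sqrt ((v + 2 * \<eta>) / v) ^ d) * ?F v z) \<partial>\<rho>)"
  proof (intro nn_integral_cong)
    fix z
    have [measurable_cong]: "sets (gaussian d \<eta> z) = sets (lebesgue_Rd d)"
      by (simp add: gaussian_def law_of_density_def)
    show "(\<integral>\<^sup>+y. ennreal (sqrt ((v + 4 * \<eta>) / (v + 2 * \<eta>)) ^ d) * ?F (v + 2 * \<eta>) y \<partial>gaussian d \<eta> z)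
        = ennreal (sqrt ((v + 4 * \<eta>) / (v + 2 * \<eta>)) ^ d) * (ennreal (sqrt ((v + 2 * \<eta>) / v) ^ d) * ?F v z)"
      by (subst nn_integral_cmult) (simp_all add: nn_integral_gaussian_exp_square[OF v \<eta>])
  qed
  also have "\<dots> = (\<integral>\<^sup>+z. ennreal (sqrt ((v + 4 * \<eta>) / v) ^ d) * ?F v z \<partial>\<rho>)"
  proof -
    have "sqrt ((v + 4 * \<eta>) / (v + 2 * \<eta>)) ^ d * sqrt ((v + 2 * \<eta>) / v) ^ d = sqrt ((v + 4 * \<eta>) / v) ^ d"
      using v \<eta> by (simp flip: power_mult_distrib real_sqrt_mult)
    moreover have "0 \<le> sqrt ((v + 4 * \<eta>) / (v + 2 * \<eta>)) ^ d" using v \<eta> by simp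
    ultimately have "ennreal (sqrt ((v + 4 * \<eta>) / (v + 2 * \<eta>)) ^ d) * ennreal (sqrt ((v + 2 * \<eta>) / v) ^ d)
        = ennreal (sqrt ((v + 4 * \<eta>) / v) ^ d)"
      by (metis ennreal_mult')
    then show ?thesis by (simp add: mult.assoc[symmetric])
  qed
  also have "\<dots> = ennreal (sqrt ((v + 4 * \<eta>) / v) ^ d) * (\<integral>\<^sup>+x. ?F v x \<partial>\<rho>)"
    using sets_\<rho> by (intro nn_integral_cmult) (simp cong: measurable_cong_sets)
  finally show ?thesis .
qed

text \<open>Since the prefactors telescope, the total loss depends only on the initial and final
  widths. The bound is the one for \<open>x\<^sub>0\<close> plus an independent Gaussian of
  covariance 2 k \<eta> I.\<close>

lemma exp_moment_proximal_law:
  assumes \<rho>0: "\<rho>0 \<in> space (prob_algebra (lebesgue_Rd d))" and u: "u > 0"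
  shows "(\<integral>\<^sup>+x. ennreal (exp ((norm_Rd d x)\<^sup>2 / (u + 4 * \<eta> * real k))) \<partial>proximal_law d \<eta> p \<rho>0 k)
    \<le> ennreal (sqrt ((u + 4 * \<eta> * real k) / u) ^ d) * (\<integral>\<^sup>+x. ennreal (exp ((norm_Rd d x)\<^sup>2 / u)) \<partial>\<rho>0)"
proof (induction k)
  case 0
  show ?case using u by simp
next
  case (Suc k)
  let ?v = "u + 4 * \<eta> * real k"
  have v: "?v > 0" using u step_pos by (simp add: add_pos_nonneg)
  have v': "u + 4 * \<eta> * real (Suc k) = ?v + 4 * \<eta>" by (simp add: algebra_simps)
  have "(\<integral>\<^sup>+x. ennreal (exp ((norm_Rd d x)\<^sup>2 / (u + 4 * \<eta> * real (Suc k)))) \<partial>proximal_law d \<eta> p \<rho>0 (Suc k))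
      \<le> ennreal (sqrt ((?v + 4 * \<eta>) / ?v) ^ d)
        * (\<integral>\<^sup>+x. ennreal (exp ((norm_Rd d x)\<^sup>2 / ?v)) \<partial>proximal_law d \<eta> p \<rho>0 k)"
    unfolding v' proximal_law.simps
    by (rule exp_moment_step[OF proximal_law_in_prob_algebra[OF \<rho>0] v])
  also have "\<dots> \<le> ennreal (sqrt ((?v + 4 * \<eta>) / ?v) ^ d)
      * (ennreal (sqrt (?v / u) ^ d) * (\<integral>\<^sup>+x. ennreal (exp ((norm_Rd d x)\<^sup>2 / u)) \<partial>\<rho>0))"
    by (intro mult_left_mono Suc) simp
  also have "\<dots> = ennreal (sqrt ((?v + 4 * \<eta>) / u) ^ d) * (\<integral>\<^sup>+x. ennreal (exp ((norm_Rd d x)\<^sup>2 / u)) \<partial>\<rho>0)"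
  proof -
    have "sqrt ((?v + 4 * \<eta>) / ?v) ^ d * sqrt (?v / u) ^ d = sqrt ((?v + 4 * \<eta>) / u) ^ d"
      using v u by (simp flip: power_mult_distrib real_sqrt_mult)
    moreover have "0 \<le> sqrt ((?v + 4 * \<eta>) / ?v) ^ d" using v step_pos by simp
    ultimately have "ennreal (sqrt ((?v + 4 * \<eta>) / ?v) ^ d) * ennreal (sqrt (?v / u) ^ d)
        = ennreal (sqrt ((?v + 4 * \<eta>) / u) ^ d)"
      by (metis ennreal_mult')
    then show ?thesis by (simp add: mult.assoc[symmetric])
  qed
  finally show ?case unfolding v' .
qed

end

section \<open>The Cauchy law: normalisation and lower bounds for its radial tail\<close>

abbreviation cauchy_law :: "nat \<Rightarrow> real \<Rightarrow> (nat \<Rightarrow> real) measure" where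
  "cauchy_law d \<nu> \<equiv> law_of_density d (cauchy_density d \<nu>)"

abbreviation cauchy_mass :: "nat \<Rightarrow> real \<Rightarrow> real" where
  "cauchy_mass d \<nu> \<equiv> LINT x|lebesgue_Rd d. cauchy_weight d \<nu> x"

lemma cauchy_density_eq: "cauchy_density d \<nu> x = cauchy_weight d \<nu> x / cauchy_mass d \<nu>"
  by (simp add: cauchy_density_def normalize_Rd_def exp_cauchy_potential)

lemma borel_measurable_cauchy_density [measurable]:
  "cauchy_density d \<nu> \<in> borel_measurable (lebesgue_Rd d)"
  unfolding cauchy_density_eq[abs_def] by measurable

locale cauchy_target =
  fixes d :: nat and \<nu> :: real
  assumes dim_pos: "d \<ge> 1" and \<nu>_pos: "\<nu> > 0"
begin

lemma cauchy_mass_pos: "cauchy_mass d \<nu> > 0"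
  by (intro integral_Rd_pos integrable_cauchy_weight dim_pos \<nu>_pos cauchy_weight_pos)

lemma radial_target_cauchy_density:
  assumes "\<eta> > 0"
  shows "radial_target d \<eta> (cauchy_density d \<nu>)"
proof
  show "integrable (lebesgue_Rd d) (cauchy_density d \<nu>)"
    unfolding cauchy_density_eq[abs_def]
    by (intro integrable_divide integrable_cauchy_weight dim_pos \<nu>_pos)
  show "cauchy_density d \<nu> x > 0" for x
    by (simp add: cauchy_density_eq cauchy_mass_pos cauchy_weight_pos)
  show "cauchy_density d \<nu> y \<le> cauchy_density d \<nu> x" if "norm_Rd d x \<le> norm_Rd d y" for x y
    using cauchy_weight_antimono[OF that \<nu>_pos] cauchy_mass_pos
    by (simp add: cauchy_density_eq divide_right_mono)
qed fact

lemma nn_integral_cauchy_law: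
  assumes [measurable]: "f \<in> borel_measurable (lebesgue_Rd d)"
  shows "(\<integral>\<^sup>+x. f x \<partial>cauchy_law d \<nu>)
    = ennreal (1 / cauchy_mass d \<nu>) * (\<integral>\<^sup>+x. ennreal (cauchy_weight d \<nu> x) * f x \<partial>lebesgue_Rd d)"
proof -
  have "ennreal (cauchy_density d \<nu> x) = ennreal (1 / cauchy_mass d \<nu>) * ennreal (cauchy_weight d \<nu> x)" for x
    using cauchy_mass_pos by (simp add: cauchy_density_eq flip: ennreal_mult')
  then show ?thesis
    by (simp add: law_of_density_def nn_integral_density nn_integral_cmult mult.assoc)
qed

lemma prob_space_cauchy_law: "prob_space (cauchy_law d \<nu>)"
proof (rule prob_spaceI)
  have "emeasure (cauchy_law d \<nu>) (space (cauchy_law d \<nu>)) = (\<integral>\<^sup>+x. 1 \<partial>cauchy_law d \<nu>)"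
    by simp
  also have "\<dots> = ennreal (1 / cauchy_mass d \<nu>) * ennreal (cauchy_mass d \<nu>)"
    using nn_integral_eq_integral[OF integrable_cauchy_weight[OF dim_pos \<nu>_pos]]
    by (subst nn_integral_cauchy_law) (simp_all add: cauchy_weight_pos less_imp_le)
  also have "\<dots> = 1"
    using cauchy_mass_pos by (simp flip: ennreal_mult')
  finally show "emeasure (cauchy_law d \<nu>) (space (cauchy_law d \<nu>)) = 1" .
qed

sublocale cauchy: prob_space "cauchy_law d \<nu>"
  by (rule prob_space_cauchy_law)

text \<open>Events are given by a predicate on the radius, so that a dilation becomes the
  substitution of t / s for t.\<close>

definition radial_prob :: "(real \<Rightarrow> bool) \<Rightarrow> real" where
  "radial_prob P = measure (cauchy_law d \<nu>) {x \<in> space (lebesgue_Rd d). P (norm_Rd d x)}"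

lemma radial_prob_le_1: "radial_prob P \<le> 1"
  by (simp add: radial_prob_def)

lemma radial_prob_not:
  assumes [measurable]: "Measurable.pred borel P"
  shows "radial_prob (\<lambda>t. \<not> P t) = 1 - radial_prob P"
proof -
  let ?A = "{x \<in> space (lebesgue_Rd d). P (norm_Rd d x)}"
  have "?A \<in> sets (cauchy_law d \<nu>)"
    by (simp add: law_of_density_def)
  moreover have "{x \<in> space (lebesgue_Rd d). \<not> P (norm_Rd d x)} = space (cauchy_law d \<nu>) - ?A"
    by (auto simp: law_of_density_def)
  ultimately show ?thesis
    unfolding radial_prob_def by (simp only: cauchy.prob_compl)
qed

lemma ennreal_radial_prob:
  assumes [measurable]: "Measurable.pred borel P"
  shows "ennreal (radial_prob P) = ennreal (1 / cauchy_mass d \<nu>)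
    * (\<integral>\<^sup>+x. ennreal (cauchy_weight d \<nu> x) * indicator {x. P (norm_Rd d x)} x \<partial>lebesgue_Rd d)"
proof -
  have [measurable]: "{x \<in> space (lebesgue_Rd d). P (norm_Rd d x)} \<in> sets (cauchy_law d \<nu>)"
    by (simp add: law_of_density_def)
  have "ennreal (radial_prob P) = (\<integral>\<^sup>+x. indicator {x. P (norm_Rd d x)} x \<partial>cauchy_law d \<nu>)"
    by (simp add: radial_prob_def flip: cauchy.emeasure_eq_measure nn_integral_indicator)
      (auto intro!: nn_integral_cong simp: law_of_density_def indicator_def)
  also have "\<dots> = ennreal (1 / cauchy_mass d \<nu>)
    * (\<integral>\<^sup>+x. ennreal (cauchy_weight d \<nu> x) * indicator {x. P (norm_Rd d x)} x \<partial>lebesgue_Rd d)"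
    by (rule nn_integral_cauchy_law) measurable
  finally show ?thesis .
qed

text \<open>Change of variables \<open>x = s z\<close>.\<close>

lemma radial_prob_dilate:
  assumes [measurable]: "Measurable.pred borel P" and s: "s > 0" and \<kappa>: "\<kappa> \<ge> 0"
    and le: "\<And>t. t \<ge> 0 \<Longrightarrow> P t \<Longrightarrow> \<kappa> * (1 + t\<^sup>2) powr (- (real d + \<nu>) / 2)
      \<le> s ^ d * (1 + (s * t)\<^sup>2) powr (- (real d + \<nu>) / 2)"
  shows "\<kappa> * radial_prob P \<le> radial_prob (\<lambda>t. P (t / s))"
proof -
  let ?W = "cauchy_weight d \<nu>" and ?c = "ennreal (1 / cauchy_mass d \<nu>)"
  let ?S = "\<lambda>x. \<lambda>i\<in>{..<d}. s * x i"
  have [measurable]: "Measurable.pred borel (\<lambda>t. P (t / s))"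
    by measurable
  have "ennreal \<kappa> * (\<integral>\<^sup>+x. ennreal (?W x) * indicator {x. P (norm_Rd d x)} x \<partial>lebesgue_Rd d)
      = (\<integral>\<^sup>+x. ennreal \<kappa> * (ennreal (?W x) * indicator {x. P (norm_Rd d x)} x) \<partial>lebesgue_Rd d)"
    by (rule nn_integral_cmult[symmetric]) measurable
  also have "\<dots> \<le> (\<integral>\<^sup>+x. ennreal (s ^ d) * (ennreal (?W (?S x)) * indicator {x. P (norm_Rd d x / s)} (?S x)) \<partial>lebesgue_Rd d)"
  proof (rule nn_integral_mono)
    fix x
    show "ennreal \<kappa> * (ennreal (?W x) * indicator {x. P (norm_Rd d x)} x)
      \<le> ennreal (s ^ d) * (ennreal (?W (?S x)) * indicator {x. P (norm_Rd d x / s)} (?S x))"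
      using le[OF norm_Rd_nonneg, of d x] s \<kappa>
      by (auto simp: indicator_def norm_Rd_scale cauchy_weight_def simp flip: ennreal_mult' intro!: ennreal_leI)
  qed
  also have "\<dots> = (\<integral>\<^sup>+x. ennreal (?W x) * indicator {x. P (norm_Rd d x / s)} x \<partial>lebesgue_Rd d)"
    using s by (subst (2) nn_integral_Rd_scale[OF _ s]) (simp_all add: nn_integral_cmult)
  finally have "?c * (ennreal \<kappa> * (\<integral>\<^sup>+x. ennreal (?W x) * indicator {x. P (norm_Rd d x)} x \<partial>lebesgue_Rd d))
      \<le> ?c * (\<integral>\<^sup>+x. ennreal (?W x) * indicator {x. P (norm_Rd d x / s)} x \<partial>lebesgue_Rd d)"
    by (rule mult_left_mono) simp
  then have "ennreal \<kappa> * ennreal (radial_prob P) \<le> ennreal (radial_prob (\<lambda>t. P (t / s)))"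
    by (simp add: ennreal_radial_prob mult.left_commute)
  then show ?thesis
    using \<kappa> by (simp add: radial_prob_def flip: ennreal_mult')
qed

text \<open>The Jacobian s^d and the factor (s^2) powr (-(d + \<nu>) / 2) combine to s powr
  (-\<nu>), and 1 + (s t)^2 is at most s^2 (1 + t^2) because s \<ge> 1.\<close>

lemma radial_prob_tail_scale:
  assumes s: "s \<ge> 1"
  shows "s powr (-\<nu>) * radial_prob (\<lambda>t. t > r) \<le> radial_prob (\<lambda>t. t > s * r)"
proof -
  have "s powr (-\<nu>) * radial_prob (\<lambda>t. t > r) \<le> radial_prob (\<lambda>t. t / s > r)"
  proof (rule radial_prob_dilate)
    fix t :: real assume "t \<ge> 0"
    let ?e = "- (real d + \<nu>) / 2"
    have "s powr (-\<nu>) * (1 + t\<^sup>2) powr ?e = s ^ d * ((s\<^sup>2) powr ?e * (1 + t\<^sup>2) powr ?e)"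
    proof -
      have "s\<^sup>2 = s powr 2" using s by simp
      then have "(s\<^sup>2) powr ?e = s powr (2 * ?e)" by (simp only: powr_powr)
      also have "2 * ?e = - \<nu> - real d" by simp
      also have "s powr (- \<nu> - real d) = s powr (-\<nu>) / s ^ d"
        using s by (simp add: powr_diff powr_realpow)
      finally show ?thesis using s by simp
    qed
    also have "(s\<^sup>2) powr ?e * (1 + t\<^sup>2) powr ?e = (s\<^sup>2 * (1 + t\<^sup>2)) powr ?e"
      by (rule powr_mult[symmetric])
    also have "\<dots> \<le> (1 + (s * t)\<^sup>2) powr ?e"
      using s \<nu>_pos one_le_power[OF s, of 2]
      by (intro powr_mono2') (auto simp: algebra_simps power_mult_distrib add_pos_nonneg)
    finally show "s powr (-\<nu>) * (1 + t\<^sup>2) powr ?e \<le> s ^ d * (1 + (s * t)\<^sup>2) powr ?e"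
      using s by (simp add: mult_left_mono)
  qed (use s in auto)
  also have "(\<lambda>t. t / s > r) = (\<lambda>t. t > s * r)"
    using s by (auto simp: field_simps fun_eq_iff)
  finally show ?thesis .
qed

text \<open>The bound in \<open>le\<close> is the Jacobian of doubling times the ratio of the
  weights at 2 t and t. Doubling the ball of radius r thus multiplies its mass by at least 3 / 2,
  and since the result is at most 1, the ball has mass at most 2 / 3.\<close>

lemma radial_prob_gt_ge:
  assumes \<kappa>: "\<kappa> \<ge> 3 / 2"
    and le: "\<And>t. 0 \<le> t \<Longrightarrow> t \<le> r \<Longrightarrow> \<kappa> \<le> 2 ^ d * ((1 + t\<^sup>2) / (1 + (2 * t)\<^sup>2)) powr ((real d + \<nu>) / 2)"
  shows "radial_prob (\<lambda>t. t > r) \<ge> 1 / 3"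
proof -
  have "\<kappa> * radial_prob (\<lambda>t. t \<le> r) \<le> radial_prob (\<lambda>t. t / 2 \<le> r)"
  proof (rule radial_prob_dilate)
    fix t :: real assume t: "t \<ge> 0" "t \<le> r"
    let ?e = "(real d + \<nu>) / 2"
    have e: "- (real d + \<nu>) / 2 = - ?e" by (rule minus_divide_left[symmetric])
    have pos: "(1 + t\<^sup>2) powr ?e > 0"
      using add_pos_nonneg[of 1 "t\<^sup>2"] by auto
    have "\<kappa> * (1 + t\<^sup>2) powr (- ?e)
        \<le> 2 ^ d * ((1 + t\<^sup>2) / (1 + (2 * t)\<^sup>2)) powr ?e * (1 + t\<^sup>2) powr (- ?e)"
      by (intro mult_right_mono le t) simp
    also have "\<dots> = 2 ^ d * (1 + (2 * t)\<^sup>2) powr (- ?e)"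
      using pos by (simp add: powr_divide powr_minus field_simps)
    finally show "\<kappa> * (1 + t\<^sup>2) powr (- (real d + \<nu>) / 2) \<le> 2 ^ d * (1 + (2 * t)\<^sup>2) powr (- (real d + \<nu>) / 2)"
      unfolding e .
  qed (use \<kappa> in auto)
  also have "\<dots> \<le> 1" by (rule radial_prob_le_1)
  finally have "\<kappa> * radial_prob (\<lambda>t. t \<le> r) \<le> 1" .
  moreover have "3 / 2 * radial_prob (\<lambda>t. t \<le> r) \<le> \<kappa> * radial_prob (\<lambda>t. t \<le> r)"
    using \<kappa> by (intro mult_right_mono) (simp_all add: radial_prob_def)
  moreover have "radial_prob (\<lambda>t. t > r) = 1 - radial_prob (\<lambda>t. t \<le> r)"
    using radial_prob_not[of "\<lambda>t. t \<le> r"] by (simp add: not_le)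
  ultimately show ?thesis by simp
qed

text \<open>At t = 0 the doubling factor is 2^d \<ge> 2, so by continuity it stays above 3 / 2 near
  0. The constant depends on d; this serves the finitely many small dimensions.\<close>

lemma radial_prob_small_radius:
  "\<exists>a>0. radial_prob (\<lambda>t. t > a * sqrt (real d)) \<ge> 1 / 3"
proof -
  let ?h = "\<lambda>t::real. 2 ^ d * ((1 + t\<^sup>2) / (1 + (2 * t)\<^sup>2)) powr ((real d + \<nu>) / 2)"
  have "1 + (2 * t)\<^sup>2 \<noteq> 0" "1 + t\<^sup>2 \<noteq> 0" for t :: real
    using add_pos_nonneg[of 1 "(2 * t)\<^sup>2"] add_pos_nonneg[of 1 "t\<^sup>2"] by simp_all
  then have "isCont ?h 0"
    by (intro continuous_intros) auto
  moreover have "?h 0 > 3 / 2"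
    using self_le_power[of "2::real" d] dim_pos by simp
  ultimately have "\<forall>\<^sub>F t in at 0. ?h t > 3 / 2"
    unfolding isCont_def by (rule order_tendstoD)
  then obtain b where b: "b > 0" "\<And>t. t \<noteq> 0 \<Longrightarrow> \<bar>t\<bar> < b \<Longrightarrow> ?h t > 3 / 2"
    by (auto simp: eventually_at dist_real_def)
  have "?h t \<ge> 3 / 2" if "0 \<le> t" "t \<le> b / 2" for t
    using b(2)[of t] that b(1) \<open>?h 0 > 3 / 2\<close> by (cases "t = 0") auto
  then have "radial_prob (\<lambda>t. t > b / 2) \<ge> 1 / 3"
    by (intro radial_prob_gt_ge[of "3 / 2"]) auto
  then have "radial_prob (\<lambda>t. t > b / 2 / sqrt (real d) * sqrt (real d)) \<ge> 1 / 3"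
    using dim_pos by simp
  then show ?thesis
    using b(1) dim_pos by (intro exI[of _ "b / 2 / sqrt (real d)"]) auto
qed

text \<open>With q the ratio (1 + t^2) / (1 + 4 t^2), the doubling factor is (4 q) powr (d / 2) * q
  powr (\<nu> / 2). The second factor is at least 2 powr (-\<nu>) because q \<ge> 1 / 4; the first
  is at least 2 powr (\<nu> + 1) because 4 q exceeds 1 by a quantity of order 1 / d.\<close>

lemma radial_prob_large_dim:
  assumes a: "a > 0" "8 * a\<^sup>2 * 4 powr (\<nu> + 1) \<le> 3" and d: "4 * a\<^sup>2 * real d \<ge> 1"
  shows "radial_prob (\<lambda>t. t > a * sqrt (real d)) \<ge> 1 / 3"
proof (rule radial_prob_gt_ge[of 2])
  fix t :: real assume t: "0 \<le> t" "t \<le> a * sqrt (real d)"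
  define q where "q = (1 + t\<^sup>2) / (1 + (2 * t)\<^sup>2)"
  have den: "1 + 4 * t\<^sup>2 > 0" by (simp add: add_pos_nonneg)
  have q: "q \<ge> 1 / 4" using den by (simp add: q_def power_mult_distrib field_simps)
  have "t\<^sup>2 \<le> a\<^sup>2 * real d"
    using power_mono[OF t(2) t(1), of 2] by (simp add: power_mult_distrib)
  \<comment> \<open>The lower bound on d absorbs the summand 1 into 4 a^2 d.\<close>
  then have le: "1 + 4 * t\<^sup>2 \<le> 8 * a\<^sup>2 * real d" using d by simp
  have "4 * q = 1 + 3 / (1 + 4 * t\<^sup>2)"
    using den by (simp add: q_def power_mult_distrib field_simps)
  also have "\<dots> \<ge> 1 + 3 / (8 * a\<^sup>2 * real d)"
    using le den dim_pos a by (intro add_left_mono divide_left_mono mult_pos_pos) auto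
  finally have "(1 + 3 / (8 * a\<^sup>2 * real d)) ^ d \<le> (4 * q) ^ d"
    by (intro power_mono) auto
  \<comment> \<open>Bernoulli turns the excess of order 1 / d into a bound free of d, large when a
    is small.\<close>
  moreover have "1 + real d * (3 / (8 * a\<^sup>2 * real d)) \<le> (1 + 3 / (8 * a\<^sup>2 * real d)) ^ d"
    by (rule Bernoulli_inequality) (simp add: order_trans[of _ 0])
  moreover have "real d * (3 / (8 * a\<^sup>2 * real d)) = 3 / (8 * a\<^sup>2)"
    using dim_pos by simp
  moreover have "4 powr (\<nu> + 1) \<le> 3 / (8 * a\<^sup>2)"
    using a by (simp add: field_simps)
  ultimately have "4 powr (\<nu> + 1) \<le> (4 * q) ^ d" by simp
  then have "(4 powr (\<nu> + 1)) powr (1 / 2) \<le> ((4 * q) ^ d) powr (1 / 2)"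
    by (intro powr_mono2) auto
  moreover have four: "(4::real) powr (x / 2) = 2 powr x" for x
    using powr_powr[of "2::real" 2 "x / 2"] by simp
  ultimately have A: "2 powr (\<nu> + 1) \<le> ((4 * q) ^ d) powr (1 / 2)"
    by (simp add: powr_powr)
  have "((4 * q) ^ d) powr (1 / 2) = (4 * q) powr (real d / 2)"
  proof -
    have "(4 * q) ^ d = (4 * q) powr real d" using q by (simp add: powr_realpow)
    then show ?thesis by (simp only: powr_powr) simp
  qed
  also have "\<dots> = 2 ^ d * q powr (real d / 2)"
    by (simp add: powr_mult four powr_realpow)
  finally have "2 powr (\<nu> + 1) \<le> 2 ^ d * q powr (real d / 2)" using A by simp
  moreover have "2 powr (-\<nu>) \<le> q powr (\<nu> / 2)"
  proof -
    have "2 powr (-\<nu>) = (1 / 4) powr (\<nu> / 2)"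
      by (simp add: powr_divide four powr_minus field_simps)
    also have "\<dots> \<le> q powr (\<nu> / 2)" using q \<nu>_pos by (intro powr_mono2) auto
    finally show ?thesis .
  qed
  ultimately have "2 powr (\<nu> + 1) * 2 powr (-\<nu>) \<le> 2 ^ d * q powr (real d / 2) * q powr (\<nu> / 2)"
    by (intro mult_mono) auto
  also have "2 powr (\<nu> + 1) * 2 powr (-\<nu>) = (2::real)"
    by (simp flip: powr_add)
  also have "2 ^ d * q powr (real d / 2) * q powr (\<nu> / 2) = 2 ^ d * q powr ((real d + \<nu>) / 2)"
    by (simp add: add_divide_distrib powr_add)
  finally show "2 \<le> 2 ^ d * ((1 + t\<^sup>2) / (1 + (2 * t)\<^sup>2)) powr ((real d + \<nu>) / 2)"
    by (simp add: q_def)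
qed simp

end

text \<open>One constant b works for all large dimensions, and the remaining finitely many each have
  their own. Their minimum works throughout, since shrinking the radius only enlarges the tail
  event; dilation by s then reaches larger radii.\<close>

lemma cauchy_tail_lower_bound:
  assumes \<nu>: "\<nu> > 0"
  shows "\<exists>a>0. \<forall>d\<ge>1. \<forall>s\<ge>1. s powr (-\<nu>) / 3
    \<le> measure (cauchy_law d \<nu>) {x \<in> space (lebesgue_Rd d). norm_Rd d x > s * (a * sqrt (real d))}"
proof -
  \<comment> \<open>The largest value allowed by \<open>radial_prob_large_dim\<close>: it gives
    equality in the smallness condition.\<close>
  define b where "b = sqrt (3 / (8 * 4 powr (\<nu> + 1)))"
  have b: "b > 0" "8 * b\<^sup>2 * 4 powr (\<nu> + 1) \<le> 3"
    by (simp_all add: b_def)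
  define D where "D = nat \<lceil>1 / (4 * b\<^sup>2)\<rceil>"
  have "\<forall>d\<ge>1. \<exists>a>0. cauchy_target.radial_prob d \<nu> (\<lambda>t. t > a * sqrt (real d)) \<ge> 1 / 3"
    using \<nu> by (intro allI impI cauchy_target.radial_prob_small_radius cauchy_target.intro)
  then obtain f where f: "\<And>d. d \<ge> 1 \<Longrightarrow> f d > 0"
    "\<And>d. d \<ge> 1 \<Longrightarrow> cauchy_target.radial_prob d \<nu> (\<lambda>t. t > f d * sqrt (real d)) \<ge> 1 / 3"
    by metis
  define a where "a = Min (insert b (f ` {1..D}))"
  have a: "a > 0" using b f by (auto simp: a_def)
  show ?thesis
  proof (intro exI[of _ a] conjI allI impI a)
    fix d :: nat and s :: real assume d: "d \<ge> 1" and s: "s \<ge> 1"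
    interpret cauchy_target d \<nu> using d \<nu> by unfold_locales
    have "\<exists>a'\<ge>a. radial_prob (\<lambda>t. t > a' * sqrt (real d)) \<ge> 1 / 3"
    proof (cases "d \<le> D")
      case True
      then have "a \<le> f d" unfolding a_def using d by (intro Min_le) auto
      then show ?thesis using f(2)[OF d] by blast
    next
      case False
      then have "1 / (4 * b\<^sup>2) \<le> real d"
        unfolding D_def by linarith
      then have "4 * b\<^sup>2 * real d \<ge> 1" using b by (simp add: field_simps)
      then have "radial_prob (\<lambda>t. t > b * sqrt (real d)) \<ge> 1 / 3"
        by (intro radial_prob_large_dim b)
      moreover have "a \<le> b" unfolding a_def by (intro Min_le) auto
      ultimately show ?thesis by blast
    qed
    then obtain a' where a': "a' \<ge> a" "radial_prob (\<lambda>t. t > a' * sqrt (real d)) \<ge> 1 / 3" by blast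
    have "1 / 3 \<le> radial_prob (\<lambda>t. t > a' * sqrt (real d))" by fact
    also have "\<dots> \<le> radial_prob (\<lambda>t. t > a * sqrt (real d))"
      unfolding radial_prob_def
      using mult_right_mono[OF a'(1), of "sqrt (real d)"]
      by (intro cauchy.finite_measure_mono) (auto simp: law_of_density_def)
    finally have "s powr (-\<nu>) * (1 / 3) \<le> s powr (-\<nu>) * radial_prob (\<lambda>t. t > a * sqrt (real d))"
      by (intro mult_left_mono) auto
    also have "\<dots> \<le> radial_prob (\<lambda>t. t > s * (a * sqrt (real d)))"
      by (rule radial_prob_tail_scale[OF s])
    finally show "s powr (-\<nu>) / 3
        \<le> measure (cauchy_law d \<nu>) {x \<in> space (lebesgue_Rd d). norm_Rd d x > s * (a * sqrt (real d))}"
      by (simp add: radial_prob_def)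
  qed
qed

section \<open>Upper bound for the tail of the iterates\<close>

text \<open>Markov's inequality for exp (|x|^2 / v). The initial moment and the growth of the
  prefactor each contribute at most a factor exp 1, which accounts for the 2 in the
  exponent.\<close>

lemma (in radial_target) proximal_law_tail:
  assumes d: "d \<ge> 1" and \<rho>0: "\<rho>0 \<in> space (prob_algebra (lebesgue_Rd d))"
    and C: "C > 0" and init: "AE x in \<rho>0. norm_Rd d x \<le> C * sqrt (real d)" and R: "R \<ge> 0"
  shows "measure (proximal_law d \<eta> p \<rho>0 N) {x \<in> space (lebesgue_Rd d). norm_Rd d x > R}
    \<le> exp (2 - R\<^sup>2 / ((8 * \<eta> * real N + C\<^sup>2) * real d))"
proof -
  \<comment> \<open>The first summand keeps the initial moment below exp 1. The second forces v / u
    \<le> 1 + 1 / d, so that the d-th power in the prefactor stays bounded independently of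
    d.\<close>
  define u where "u = C\<^sup>2 * real d + 4 * \<eta> * real N * real d"
  define v where "v = u + 4 * \<eta> * real N"
  let ?\<rho> = "proximal_law d \<eta> p \<rho>0 N" and ?A = "{x \<in> space (lebesgue_Rd d). norm_Rd d x > R}"
  have \<eta>N: "0 \<le> \<eta> * real N" using step_pos by simp
  have u: "u > 0" using C d \<eta>N by (simp add: u_def add_pos_nonneg)
  have v: "v > 0" using u \<eta>N by (simp add: v_def add_pos_nonneg)
  have "4 * \<eta> * real N \<le> 4 * \<eta> * real N * real d"
    using \<eta>N d mult_left_mono[of 1 "real d" "4 * (\<eta> * real N)"] by (simp add: mult.assoc)
  then have v_le: "v \<le> (8 * \<eta> * real N + C\<^sup>2) * real d"
    by (simp add: v_def u_def algebra_simps)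
  have \<rho>: "?\<rho> \<in> space (prob_algebra (lebesgue_Rd d))"
    by (rule proximal_law_in_prob_algebra[OF \<rho>0])
  interpret \<rho>: prob_space ?\<rho> using \<rho> by (simp add: space_prob_algebra)
  interpret \<rho>0: prob_space \<rho>0 using \<rho>0 by (simp add: space_prob_algebra)
  have sets_\<rho>: "sets ?\<rho> = sets (lebesgue_Rd d)" using \<rho> by (simp add: space_prob_algebra)
  have init_moment: "(\<integral>\<^sup>+x. ennreal (exp ((norm_Rd d x)\<^sup>2 / u)) \<partial>\<rho>0) \<le> ennreal (exp 1)"
  proof -
    have "(\<integral>\<^sup>+x. ennreal (exp ((norm_Rd d x)\<^sup>2 / u)) \<partial>\<rho>0) \<le> (\<integral>\<^sup>+x. ennreal (exp 1) \<partial>\<rho>0)"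
    proof (rule nn_integral_mono_AE, use init in eventually_elim)
      fix x assume "norm_Rd d x \<le> C * sqrt (real d)"
      then have "(norm_Rd d x)\<^sup>2 \<le> (C * sqrt (real d))\<^sup>2"
        by (intro power_mono norm_Rd_nonneg)
      also have "\<dots> \<le> u" using \<eta>N by (simp add: u_def power_mult_distrib)
      finally show "ennreal (exp ((norm_Rd d x)\<^sup>2 / u)) \<le> ennreal (exp 1)"
        using u by (intro ennreal_leI) simp
    qed
    then show ?thesis by (simp add: \<rho>0.emeasure_space_1)
  qed
  have growth: "sqrt (v / u) ^ d \<le> exp 1"
  proof -
    have "4 * \<eta> * real N * real d \<le> u" using C by (simp add: u_def)
    then have "v / u \<le> 1 + 1 / real d"
      using u d by (simp add: v_def field_simps)
    also have "\<dots> \<le> exp (1 / real d)" by (rule exp_ge_add_one_self)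
    finally have le: "v / u \<le> exp (1 / real d)" .
    have "v / u \<ge> 1" using u \<eta>N by (simp add: v_def)
    then have "sqrt (v / u) \<le> v / u"
      by (intro real_le_lsqrt) (auto intro: self_le_power)
    then have "sqrt (v / u) ^ d \<le> exp (1 / real d) ^ d"
      using le u v by (intro power_mono) auto
    also have "\<dots> = exp 1" using d by (simp flip: exp_of_nat_mult)
    finally show ?thesis .
  qed
  have "ennreal (exp (R\<^sup>2 / v) * measure ?\<rho> ?A) = (\<integral>\<^sup>+x. ennreal (exp (R\<^sup>2 / v)) * indicator ?A x \<partial>?\<rho>)"
    using sets_\<rho> by (subst nn_integral_cmult_indicator) (auto simp: \<rho>.emeasure_eq_measure ennreal_mult)
  also have "\<dots> \<le> (\<integral>\<^sup>+x. ennreal (exp ((norm_Rd d x)\<^sup>2 / v)) \<partial>?\<rho>)"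
    using v R by (intro nn_integral_mono)
      (auto simp: indicator_def intro!: ennreal_leI divide_right_mono power_mono)
  also have "\<dots> \<le> ennreal (sqrt (v / u) ^ d) * (\<integral>\<^sup>+x. ennreal (exp ((norm_Rd d x)\<^sup>2 / u)) \<partial>\<rho>0)"
    unfolding v_def by (rule exp_moment_proximal_law[OF \<rho>0 u])
  also have "\<dots> \<le> ennreal (exp 1) * ennreal (exp 1)"
    by (intro mult_mono init_moment ennreal_leI growth) auto
  also have "\<dots> = ennreal (exp 2)"
    by (simp flip: ennreal_mult' exp_add)
  finally have "exp (R\<^sup>2 / v) * measure ?\<rho> ?A \<le> exp 2" by simp
  then have "measure ?\<rho> ?A \<le> exp (2 - R\<^sup>2 / v)"
    by (simp add: exp_diff field_simps)
  also have "\<dots> \<le> exp (2 - R\<^sup>2 / ((8 * \<eta> * real N + C\<^sup>2) * real d))"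
    using v v_le by (simp add: divide_left_mono)
  finally show ?thesis .
qed

section \<open>Total variation and comparison of the two tails\<close>

text \<open>A real supremum is an upper bound only for a bounded family; the differences of
  probabilities are bounded by 1.\<close>

lemma measure_diff_le_TV:
  assumes "prob_space \<mu>" "prob_space \<nu>" "A \<in> sets \<mu>"
  shows "measure \<mu> A - measure \<nu> A \<le> TV \<mu> \<nu>"
proof -
  have "\<bar>measure \<mu> B - measure \<nu> B\<bar> \<le> 1" for B
    using prob_space.prob_le_1[OF assms(1), of B] prob_space.prob_le_1[OF assms(2), of B]
      measure_nonneg[of \<mu> B] measure_nonneg[of \<nu> B] by linarith
  then have "bdd_above ((\<lambda>A. \<bar>measure \<mu> A - measure \<nu> A\<bar>) ` sets \<mu>)"
    by (intro bdd_aboveI[of _ 1]) auto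
  from cSUP_upper[OF assms(3) this] show ?thesis by (simp add: TV_def)
qed

text \<open>The exponent \<open>p\<close> is that of the logarithms allowed in the step size. The
  constants \<open>c\<close>, \<open>q\<close> and \<open>\<epsilon>\<^sub>0\<close> precede the
  dimension in the quantifier order, so they depend only on \<nu>, \<open>C\<^sub>0\<close>,
  \<open>C\<^sub>\<eta>\<close> and \<open>p\<close>.\<close>

theorem corollary2p2:
  fixes \<nu> C\<^sub>0 C\<^sub>\<eta> :: real and p :: nat
  assumes "\<nu> > 0" and "C\<^sub>0 > 0" and "C\<^sub>\<eta> > 0"
  shows "\<exists>c > 0. \<exists>q :: nat. \<exists>\<epsilon>\<^sub>0. 0 < \<epsilon>\<^sub>0 \<and> \<epsilon>\<^sub>0 < 1 \<and>
    (\<forall>d \<epsilon> \<eta> \<rho>0 N. let L = real d + \<nu> in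
       d \<ge> 1 \<and> 0 < \<epsilon> \<and> \<epsilon> \<le> \<epsilon>\<^sub>0 \<and>
       0 < \<eta> \<and> \<eta> \<le> C\<^sub>\<eta> * polylog p d \<epsilon> / (L * sqrt (real d)) \<and>
       prob_space \<rho>0 \<and> sets \<rho>0 = sets (lebesgue_Rd d) \<and>
       (AE x in \<rho>0. norm_Rd d x \<le> C\<^sub>0 * sqrt (real d)) \<and>
       TV (law_of_density d (cauchy_density d \<nu>)) (proximal_law d \<eta> (cauchy_density d \<nu>) \<rho>0 N) \<le> \<epsilon>
       \<longrightarrow> real N \<ge> c * real d powr (3 / 2) * \<epsilon> powr (- 2 / \<nu>) / polylog q d \<epsilon>)"
proof -
  from cauchy_tail_lower_bound[OF assms(1)] obtain a where a: "a > 0"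
    and tail: "\<And>d s. d \<ge> 1 \<Longrightarrow> s \<ge> 1 \<Longrightarrow> s powr (-\<nu>) / 3
      \<le> measure (cauchy_law d \<nu>) {x \<in> space (lebesgue_Rd d). norm_Rd d x > s * (a * sqrt (real d))}"
    by blast
  \<comment> \<open>K is chosen so that K * \<epsilon> powr (-2 / \<nu>) equals R^2 / d for the
    radius R = s a sqrt d used below.\<close>
  define K where "K = a\<^sup>2 * (1 / 6) powr (2 / \<nu>)"
  have K: "K > 0" using a by (simp add: K_def)
  \<comment> \<open>Logarithms are negligible against powers of \<epsilon>; this will make the
    contribution of the starting point at most half of the main term.\<close>
  have "((\<lambda>\<epsilon>. (2 + ln (1 / \<epsilon>)) * \<epsilon> powr (2 / \<nu>)) \<longlongrightarrow> 0) (at_right 0)"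
    using assms(1) by real_asymp
  then have "\<forall>\<^sub>F \<epsilon> in at_right 0. (2 + ln (1 / \<epsilon>)) * \<epsilon> powr (2 / \<nu>) < K / (2 * C\<^sub>0\<^sup>2)"
    using K assms(2) by (intro order_tendstoD) auto
  then obtain \<epsilon>\<^sub>1 where \<epsilon>\<^sub>1: "\<epsilon>\<^sub>1 > 0"
    "\<And>\<epsilon>. 0 < \<epsilon> \<Longrightarrow> \<epsilon> < \<epsilon>\<^sub>1 \<Longrightarrow> (2 + ln (1 / \<epsilon>)) * \<epsilon> powr (2 / \<nu>) < K / (2 * C\<^sub>0\<^sup>2)"
    by (auto simp: eventually_at_right_field)
  have main: "K / (32 * C\<^sub>\<eta>) * real d powr (3 / 2) * \<epsilon> powr (- 2 / \<nu>) / polylog (Suc p) d \<epsilon> \<le> real N"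
    if d: "d \<ge> 1" and \<epsilon>: "0 < \<epsilon>" "\<epsilon> < \<epsilon>\<^sub>1" "\<epsilon> \<le> 1 / 6"
      and \<eta>: "0 < \<eta>" "\<eta> \<le> C\<^sub>\<eta> * polylog p d \<epsilon> / ((real d + \<nu>) * sqrt (real d))"
      and \<rho>0: "prob_space \<rho>0" "sets \<rho>0 = sets (lebesgue_Rd d)"
      and init: "AE x in \<rho>0. norm_Rd d x \<le> C\<^sub>0 * sqrt (real d)"
      and TV: "TV (cauchy_law d \<nu>) (proximal_law d \<eta> (cauchy_density d \<nu>) \<rho>0 N) \<le> \<epsilon>"
    for d N :: nat and \<epsilon> \<eta> :: real and \<rho>0
  proof -
    interpret cauchy_target d \<nu> using d assms(1) by unfold_locales
    interpret radial_target d \<eta> "cauchy_density d \<nu>"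
      by (rule radial_target_cauchy_density[OF \<eta>(1)])
    \<comment> \<open>The solution of s powr (-\<nu>) / 3 = 2 \<epsilon>; the requirement s \<ge> 1
      is where \<epsilon> \<le> 1 / 6 enters.\<close>
    define s where "s = (1 / 6 * (1 / \<epsilon>)) powr (1 / \<nu>)"
    define E where "E = \<epsilon> powr (- 2 / \<nu>)"
    define l where "l = 2 + ln (1 / \<epsilon>)"
    define P where "P = 1 + ln (real d) + ln (1 / \<epsilon>)"
    define X where "X = 8 * \<eta> * real N + C\<^sub>0\<^sup>2"
    let ?A = "{x \<in> space (lebesgue_Rd d). norm_Rd d x > s * (a * sqrt (real d))}"
    let ?\<rho> = "proximal_law d \<eta> (cauchy_density d \<nu>) \<rho>0 N"
    define M where "M = (real d + \<nu>) * sqrt (real d)"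
    have M: "M > 0" using d assms(1) by (simp add: M_def)
    have E: "E > 0" using \<epsilon> by (simp add: E_def)
    have ln\<epsilon>: "ln (1 / \<epsilon>) \<ge> 0" using \<epsilon> by simp
    have l: "l > 0" using ln\<epsilon> by (simp add: l_def)
    have P: "P \<ge> 1" using ln\<epsilon> d by (simp add: P_def)
    have lP: "l \<le> 2 * P" using ln\<epsilon> d by (simp add: P_def l_def)
    have \<eta>': "\<eta> \<le> C\<^sub>\<eta> * P ^ p / M"
      using \<eta>(2) by (simp add: polylog_def P_def M_def)
    have X: "X > 0" using \<eta> assms(2) by (simp add: X_def add_nonneg_pos)
    have s: "s \<ge> 1"
      unfolding s_def using \<epsilon> assms(1) by (intro ge_one_powr_ge_zero) (auto simp: field_simps)
    have s_pow: "s powr (-\<nu>) = 6 * \<epsilon>"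
    proof -
      have "s powr (-\<nu>) = (1 / 6 * (1 / \<epsilon>)) powr (- 1)"
        unfolding s_def powr_powr using assms(1) by simp
      then show ?thesis using \<epsilon> by (simp add: powr_minus_divide)
    qed
    have s_sq: "s\<^sup>2 = (1 / 6) powr (2 / \<nu>) * E"
    proof -
      have "s\<^sup>2 = s powr 2" using s by simp
      also have "\<dots> = (1 / 6 * (1 / \<epsilon>)) powr (2 / \<nu>)" by (simp add: s_def powr_powr)
      also have "\<dots> = (1 / 6) powr (2 / \<nu>) * (1 / \<epsilon>) powr (2 / \<nu>)" by (rule powr_mult)
      also have "(1 / \<epsilon>) powr (2 / \<nu>) = E"
        using \<epsilon> by (simp add: E_def powr_divide powr_minus_divide)
      finally show ?thesis .
    qed
    have \<rho>0': "\<rho>0 \<in> space (prob_algebra (lebesgue_Rd d))"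
      using \<rho>0 by (simp add: space_prob_algebra)
    have \<rho>: "prob_space ?\<rho>"
      using proximal_law_in_prob_algebra[OF \<rho>0'] by (simp add: space_prob_algebra)
    have A: "?A \<in> sets (cauchy_law d \<nu>)" by (simp add: law_of_density_def)
    \<comment> \<open>The target gives the event mass at least 2 \<epsilon> and the total variation
      is at most \<epsilon>, so the chain must give it mass at least \<epsilon>.\<close>
    have "2 * \<epsilon> \<le> measure (cauchy_law d \<nu>) ?A" using tail[OF d s] s_pow by simp
    also have "\<dots> \<le> measure ?\<rho> ?A + \<epsilon>"
      using measure_diff_le_TV[OF prob_space_cauchy_law \<rho> A] TV by simp
    also have "measure ?\<rho> ?A \<le> exp (2 - (s * (a * sqrt (real d)))\<^sup>2 / (X * real d))"
      unfolding X_def using s a by (intro proximal_law_tail d \<rho>0' assms(2) init) simp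
    also have "(s * (a * sqrt (real d)))\<^sup>2 / (X * real d) = K * E / X"
      using d by (simp add: power_mult_distrib s_sq K_def)
    finally have "\<epsilon> \<le> exp (2 - K * E / X)" by simp
    then have "ln \<epsilon> \<le> 2 - K * E / X" using \<epsilon> by (metis exp_gt_zero ln_exp ln_le_cancel_iff)
    then have "K * E / X \<le> l" using \<epsilon> by (simp add: l_def ln_div)
    then have "K * E \<le> l * X" using X by (simp add: field_simps)
    \<comment> \<open>The part of \<open>l * X\<close> coming from \<open>C\<^sub>0\<close> is
      absorbed into half of the left side, leaving only the term with \<eta> N.\<close>
    moreover have "l * C\<^sub>0\<^sup>2 \<le> K * E / 2"
    proof -
      have "\<epsilon> powr (2 / \<nu>) = 1 / E" by (simp add: E_def powr_minus_divide)
      then have "l / E \<le> K / (2 * C\<^sub>0\<^sup>2)" using \<epsilon>\<^sub>1(2)[OF \<epsilon>(1,2)] by (simp add: l_def)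
      then show ?thesis using E assms(2) by (simp add: field_simps)
    qed
    ultimately have "K * E / 2 \<le> 8 * l * \<eta> * real N" by (simp add: X_def algebra_simps)
    \<comment> \<open>The logarithm l costs one more factor P beyond the P^p in the step size, hence
      the exponent \<open>Suc p\<close> in the conclusion.\<close>
    also have "\<dots> \<le> 8 * (2 * P) * (C\<^sub>\<eta> * P ^ p / M) * real N"
      using lP l \<eta>(1) \<eta>' P M assms by (intro mult_mono) auto
    finally have "K * E * M \<le> 32 * C\<^sub>\<eta> * P ^ Suc p * real N"
      using M by (simp add: field_simps)
    moreover have "K * E * real d powr (3 / 2) \<le> K * E * M"
    proof -
      have "real d powr (3 / 2) = real d powr (1 + 1 / 2)" by simp
      also have "\<dots> = real d * sqrt (real d)"
        unfolding powr_add using d by (simp add: powr_half_sqrt)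
      also have "\<dots> \<le> M"
        unfolding M_def using assms(1) by (intro mult_right_mono) auto
      finally show ?thesis using K E by (intro mult_left_mono) auto
    qed
    ultimately have "K * E * real d powr (3 / 2) \<le> 32 * C\<^sub>\<eta> * P ^ Suc p * real N" by simp
    moreover have "P ^ Suc p > 0" using P by simp
    ultimately have "K / (32 * C\<^sub>\<eta>) * real d powr (3 / 2) * E / P ^ Suc p \<le> real N"
      using assms(3) by (simp add: field_simps del: power_Suc)
    then show ?thesis by (simp only: polylog_def P_def E_def)
  qed
  show ?thesis
  proof (intro exI conjI allI)
    show "K / (32 * C\<^sub>\<eta>) > 0" using K assms(3) by simp
    \<comment> \<open>Halving \<open>\<epsilon>\<^sub>1\<close> turns the non-strict bound on
      \<epsilon> into the strict one needed by \<open>main\<close>.\<close>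
    show "0 < min (\<epsilon>\<^sub>1 / 2) (1 / 6)" "min (\<epsilon>\<^sub>1 / 2) (1 / 6) < 1" using \<epsilon>\<^sub>1(1) by auto
    fix d N :: nat and \<epsilon> \<eta> :: real and \<rho>0 :: "(nat \<Rightarrow> real) measure"
    show "let L = real d + \<nu> in
       d \<ge> 1 \<and> 0 < \<epsilon> \<and> \<epsilon> \<le> min (\<epsilon>\<^sub>1 / 2) (1 / 6) \<and>
       0 < \<eta> \<and> \<eta> \<le> C\<^sub>\<eta> * polylog p d \<epsilon> / (L * sqrt (real d)) \<and>
       prob_space \<rho>0 \<and> sets \<rho>0 = sets (lebesgue_Rd d) \<and>
       (AE x in \<rho>0. norm_Rd d x \<le> C\<^sub>0 * sqrt (real d)) \<and>
       TV (law_of_density d (cauchy_density d \<nu>)) (proximal_law d \<eta> (cauchy_density d \<nu>) \<rho>0 N) \<le> \<epsilon>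
       \<longrightarrow> real N \<ge> K / (32 * C\<^sub>\<eta>) * real d powr (3 / 2) * \<epsilon> powr (- 2 / \<nu>) / polylog (Suc p) d \<epsilon>"
      unfolding Let_def using \<epsilon>\<^sub>1(1) main[of d \<epsilon> \<eta> \<rho>0 N] by auto
  qed
qed

end
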